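(* Let $a$ be an integer and $b$ a positive integer. If no positive integer $n$ with $n \equiv a \pmod b$ can be written as $n = p + 2^k$ with $p$ a prime and $k$ a natural number, then $b \geq 11184810$.
   Context: $11184810 = 2 \times 3 \times 5 \times 7 \times 13 \times 17 \times 241$.
   Formalization: The formal theorem also assumes that every positive integer n ≡ a (mod b) is odd; without this the claim is false, for example for a = 16, b = 24, where no n ≡ 16 (mod 24) is a prime plus a power of 2. *)

theory Defs
  imports "HOL-Number_Theory.Number_Theory"
begin

(* The theorem concerns progressions of odd integers. Without oddness the bound fails, as the
   progression 16 (mod 24) shows: n - 1 is a proper multiple of 3, and n - 2^k with k >= 1 is
   even and different from 2. *)
lemma unrestricted_version_false:
  "\<not> (\<exists>n::int. n > 0 \<and> [n = 16] (mod 24) \<and> (\<exists>p k. prime p \<and> n = p + 2 ^ k))"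
proof clarify
  fix p :: int and k :: nat
  assume pos: "p + 2 ^ k > 0" and cong: "[p + 2 ^ k = 16] (mod 24)" and p: "prime p"
  have "p > 1" using p by (rule prime_gt_1_int)
  show False
  proof (cases "k = 0")
    case True
    then have "(p + 1) mod 24 = 16" using cong by (simp add: cong_def)
    then have "3 dvd p" "p \<noteq> 3" by presburger+
    then show False using p prime_int_iff[of p] by (metis numeral_eq_one_iff semiring_norm(84) zero_le_numeral)
  next
    case False
    have r: "(p + 2 ^ k) mod 24 = 16" using cong by (simp add: cong_def)
    have ev: "even m" if "m mod 24 = 16" for m :: int using that by presburger
    have "even (p + 2 ^ k)" using ev[OF r] .
    then have "even p" using False by simp
    then have p2: "p = 2" using p prime_int_iff[of p] by (metis numeral_eq_one_iff semiring_norm(83) zero_le_numeral)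
    show False
    proof (cases "k < 3")
      case True
      then have "k = 1 \<or> k = 2" using False by auto
      then show False using r p2 by auto
    next
      case False
      then have "(8::int) dvd 2 ^ k" using le_imp_power_dvd[of 3 k "2::int"] by simp
      then obtain j :: int where "2 ^ k = 8 * j" by (elim dvdE)
      then have "(2 + 8 * j) mod 24 = 16" using r p2 by simp
      then show False by presburger
    qed
  qed
qed

end

(* If some a - 2^k were coprime to b, Dirichlet's theorem would give a prime p congruent to
   a - 2^k modulo b, and p + 2^k would be a forbidden member of the progression. So every k >= 1
   satisfies 2^k = a (mod p) for some odd prime p dividing b. Each p catches at most one residue
   class of exponents modulo the order of 2 modulo p. In a minimal covering of the exponents by such
   classes, either none or at least q of the orders are divisible by a given power of the prime q.
   Together with counting densities along progressions that avoid 3, 5 and 17, and with lower bounds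
   for products of distinct primes in a residue class, this forces all orders to divide 24 if the
   product of the primes is below 5592405 = 11184810 / 2. The candidates are then the prime divisors
   3, 5, 7, 13, 17, 241 of 2^24 - 1, all six are needed, and their product is exactly 5592405.

   Dirichlet's theorem is proved in the elementary way of Mertens and Shapiro, through the sums of
   chi(k) Lambda(k) / k: they are bounded if L(1, chi) is nonzero and equal -ln x + O(1) otherwise. *)
theory Submission
  imports Defs "HOL-Computational_Algebra.Squarefree" "HOL-Analysis.Summation_Tests"
begin

text \<open>The density count alone is too weak: 3, 5 and 7 have orders 2, 4 and 3 with 1/2 + 1/4 +
  1/3 > 1, yet they do not cover the exponents. The loss comes from overlaps. Passing to
  progressions of difference 2, 4 and 8 that 3, then 5, then 17 never hit removes their large terms;
  in return the order of 2 is replaced by that of \<open>2 ^ D\<close>, so even orders shrink. The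
  four resulting inequalities force the six primes one after another.

  The product bounds rest on \<open>p - 1\<close> being a multiple of the order. For
  \<open>q \<ge> 5\<close>, \<open>q\<close> primes congruent to 1 modulo \<open>2 * q\<close>
  already have too large a product. Real work is left for orders divisible by 9 or 16, where three
  or two such primes still fit under the bound; the product then restricts the other primes so much
  that a density inequality fails.

  For Dirichlet's theorem the obstacle is \<open>L(1, \<chi>) = 0\<close>. Nonnegativity of a sum
  over all characters allows at most one such character, which must then equal its conjugate.
  Monsky's argument with a Lambert series excludes the real ones.\<close>

unbundle no vec_syntax

section \<open>Dirichlet characters\<close>

text \<open>A character of a subgroup \<open>H\<close> of the units modulo \<open>n\<close>. Both live on the natural numbers, so
  \<open>H\<close> is a union of residue classes.\<close>

definition partial_char :: "nat \<Rightarrow> nat set \<Rightarrow> (nat \<Rightarrow> complex) \<Rightarrow> bool" where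
  "partial_char n H \<chi> \<longleftrightarrow> 1 \<in> H \<and> (\<forall>x\<in>H. coprime x n \<and> \<chi> x \<noteq> 0) \<and>
     (\<forall>x\<in>H. \<forall>y\<in>H. x * y \<in> H \<and> \<chi> (x * y) = \<chi> x * \<chi> y) \<and>
     (\<forall>x\<in>H. \<forall>y. [x = y] (mod n) \<longrightarrow> y \<in> H \<and> \<chi> y = \<chi> x)"

lemma
  assumes "partial_char n H \<chi>"
  shows partial_char_one: "1 \<in> H" "\<chi> 1 = 1"
    and partial_char_coprime: "x \<in> H \<Longrightarrow> coprime x n"
    and partial_char_nonzero: "x \<in> H \<Longrightarrow> \<chi> x \<noteq> 0"
    and partial_char_mult: "x \<in> H \<Longrightarrow> y \<in> H \<Longrightarrow> x * y \<in> H"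
      "x \<in> H \<Longrightarrow> y \<in> H \<Longrightarrow> \<chi> (x * y) = \<chi> x * \<chi> y"
    and partial_char_cong: "x \<in> H \<Longrightarrow> [x = y] (mod n) \<Longrightarrow> y \<in> H"
      "x \<in> H \<Longrightarrow> [x = y] (mod n) \<Longrightarrow> \<chi> y = \<chi> x"
proof -
  show one: "1 \<in> H" using assms unfolding partial_char_def by blast
  have "\<chi> (1 * 1) = \<chi> 1 * \<chi> 1" "\<chi> 1 \<noteq> 0"
    using assms one unfolding partial_char_def by blast+
  then show "\<chi> 1 = 1" by simp
qed (use assms in \<open>unfold partial_char_def, blast\<close>)+

lemma partial_char_power:
  assumes "partial_char n H \<chi>" "x \<in> H"
  shows "x ^ k \<in> H \<and> \<chi> (x ^ k) = \<chi> x ^ k"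
proof (induction k)
  case 0
  then show ?case using partial_char_one[OF assms(1)] by simp
next
  case (Suc k)
  then show ?case using partial_char_mult[OF assms(1,2)] by simp
qed

text \<open>A power of \<open>x\<close> inverts it modulo \<open>n\<close> by Euler's theorem, so
  closure under products already gives closure under division.\<close>

lemma partial_char_cancel:
  assumes "partial_char n H \<chi>" "n > 0" "x \<in> H" "x * y \<in> H"
  shows "y \<in> H"
proof -
  have cop: "coprime x n" using partial_char_coprime[OF assms(1,3)] .
  have "totient n > 0" using assms(2) by simp
  then have "x ^ (totient n - 1) * (x * y) = x ^ totient n * y"
    by (cases "totient n") (auto simp: algebra_simps)
  moreover have "[x ^ totient n * y = 1 * y] (mod n)"
    using euler_theorem[OF cop] by (rule cong_scalar_right)
  ultimately have "[x ^ (totient n - 1) * (x * y) = y] (mod n)" by (metis mult_1)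
  moreover have "x ^ (totient n - 1) * (x * y) \<in> H"
    using partial_char_mult(1)[OF assms(1) _ assms(4)] partial_char_power[OF assms(1,3)] by blast
  ultimately show ?thesis using partial_char_cong(1)[OF assms(1)] by blast
qed

text \<open>The value \<open>z\<close> at the new element \<open>g\<close> may be any root of \<open>z\<^sup>m = \<chi> (g\<^sup>m)\<close>. For trivial \<open>H\<close> this freedom
  yields a character that separates \<open>g\<close> from 1.\<close>

lemma partial_char_extend_one:
  fixes z :: complex
  assumes pc: "partial_char n H \<chi>" and n: "n > 0" and g: "coprime g n"
    and m: "m > 0" "g ^ m \<in> H" and least: "\<And>r. 0 < r \<Longrightarrow> r < m \<Longrightarrow> g ^ r \<notin> H"
    and z: "z ^ m = \<chi> (g ^ m)"
  shows "\<exists>H' \<chi>'. partial_char n H' \<chi>' \<and> H \<subseteq> H' \<and> g \<in> H' \<and> \<chi>' g = z \<and> (\<forall>x\<in>H. \<chi>' x = \<chi> x)"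
proof -
  note mult = partial_char_mult[OF pc]
  have dvd: "m dvd k" if "g ^ k \<in> H" for k
  proof -
    have "g ^ k = (g ^ m) ^ (k div m) * g ^ (k mod m)"
      by (simp flip: power_mult power_add)
    then have "g ^ (k mod m) \<in> H"
      using partial_char_cancel[OF pc n, of "(g ^ m) ^ (k div m)"] that
        partial_char_power[OF pc m(2)] by simp
    then show ?thesis using least[of "k mod m"] m(1) by fastforce
  qed
  have z0: "z \<noteq> 0"
    using z m(1) partial_char_nonzero[OF pc m(2)] by (metis power_0_left less_irrefl)
  \<comment> \<open>Well-definedness of the value on the class of \<open>h * g ^ i\<close>. Two
    representations leave \<open>g ^ (j - i)\<close> in \<open>H\<close>, so \<open>m\<close>
    divides \<open>j - i\<close>, and there \<open>z ^ m = \<chi> (g ^ m)\<close> applies.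
    Subtraction of naturals asks for \<open>i \<le> j\<close>; the other case is symmetric.\<close>
  have wd_le: "\<chi> h * z ^ i = \<chi> h' * z ^ j"
    if h: "h \<in> H" "h' \<in> H" and c: "[h * g ^ i = h' * g ^ j] (mod n)" and ij: "i \<le> j" for h h' i j
  proof -
    have "h' * g ^ j = (h' * g ^ (j - i)) * g ^ i"
      using ij by (simp flip: power_add)
    then have "[h * g ^ i = (h' * g ^ (j - i)) * g ^ i] (mod n)" using c by metis
    then have c': "[h = h' * g ^ (j - i)] (mod n)"
      using g by (subst (asm) cong_mult_rcancel_nat) auto
    have mem: "h' * g ^ (j - i) \<in> H" using partial_char_cong(1)[OF pc h(1) c'] .
    have gm: "g ^ (j - i) \<in> H" using partial_char_cancel[OF pc n h(2) mem] .
    then obtain q where q: "j - i = m * q" using dvd by blast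
    have "\<chi> h = \<chi> (h' * g ^ (j - i))" using partial_char_cong(2)[OF pc h(1) c'] by simp
    also have "\<dots> = \<chi> h' * \<chi> ((g ^ m) ^ q)" using mult(2)[OF h(2) gm] q by (simp add: power_mult)
    also have "\<chi> ((g ^ m) ^ q) = z ^ (j - i)"
      using partial_char_power[OF pc m(2)] z q by (simp add: power_mult)
    finally show ?thesis using ij by (simp add: mult.assoc flip: power_add)
  qed
  have wd: "\<chi> h * z ^ i = \<chi> h' * z ^ j"
    if "h \<in> H" "h' \<in> H" "[h * g ^ i = h' * g ^ j] (mod n)" for h h' i j
    using wd_le[of h h' i j] wd_le[of h' h j i] that by (cases "i \<le> j") (auto simp: cong_sym)
  define H' where "H' = {y. \<exists>h\<in>H. \<exists>i. [h * g ^ i = y] (mod n)}"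
  define \<chi>' where "\<chi>' = (\<lambda>y. THE w. \<exists>h\<in>H. \<exists>i. [h * g ^ i = y] (mod n) \<and> w = \<chi> h * z ^ i)"
  have val: "\<chi>' y = \<chi> h * z ^ i" if "h \<in> H" "[h * g ^ i = y] (mod n)" for h i y
    unfolding \<chi>'_def
  proof (rule the_equality)
    show "\<exists>h'\<in>H. \<exists>i'. [h' * g ^ i' = y] (mod n) \<and> \<chi> h * z ^ i = \<chi> h' * z ^ i'" using that by blast
    show "w = \<chi> h * z ^ i" if "\<exists>h\<in>H. \<exists>i. [h * g ^ i = y] (mod n) \<and> w = \<chi> h * z ^ i" for w
      using that \<open>h \<in> H\<close> \<open>[h * g ^ i = y] (mod n)\<close> wd by (metis cong_sym cong_trans)
  qed
  have one: "1 \<in> H" "\<chi> 1 = 1" using partial_char_one[OF pc] by auto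
  have sub: "x \<in> H' \<and> \<chi>' x = \<chi> x" if "x \<in> H" for x
    using that val[of x 0 x] unfolding H'_def by (auto intro!: bexI[of _ x] exI[of _ 0])
  have gval: "g \<in> H' \<and> \<chi>' g = z"
    using val[of 1 1 g] one unfolding H'_def by (auto intro!: bexI[of _ 1] exI[of _ 1])
  have "partial_char n H' \<chi>'"
    unfolding partial_char_def
  proof (intro conjI ballI allI impI)
    show "1 \<in> H'" using sub one by blast
    fix x assume "x \<in> H'"
    then obtain h i where h: "h \<in> H" "[h * g ^ i = x] (mod n)" unfolding H'_def by blast
    have "coprime (h * g ^ i) n" using partial_char_coprime[OF pc h(1)] g by simp
    then show "coprime x n" using h(2) by (metis cong_imp_coprime)
    show "\<chi>' x \<noteq> 0" using val[OF h] partial_char_nonzero[OF pc h(1)] z0 by simp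
    {
      fix y assume "y \<in> H'"
      then obtain h' i' where h': "h' \<in> H" "[h' * g ^ i' = y] (mod n)" unfolding H'_def by blast
      have eq: "(h * g ^ i) * (h' * g ^ i') = (h * h') * g ^ (i + i')"
        by (simp add: power_add algebra_simps)
      have *: "h * h' \<in> H" "[(h * h') * g ^ (i + i') = x * y] (mod n)"
        using mult(1)[OF h(1) h'(1)] cong_mult[OF h(2) h'(2)] eq by simp_all
      then show "x * y \<in> H'" unfolding H'_def by blast
      show "\<chi>' (x * y) = \<chi>' x * \<chi>' y"
        using val[OF *] val[OF h] val[OF h'] mult(2)[OF h(1) h'(1)] by (simp add: power_add)
    }
    fix y assume "[x = y] (mod n)"
    then have *: "[h * g ^ i = y] (mod n)" using h(2) cong_trans by blast
    then show "y \<in> H'" using h(1) unfolding H'_def by blast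
    show "\<chi>' y = \<chi>' x" using val[OF h] val[OF h(1) *] by simp
  qed
  then show ?thesis using sub gval by blast
qed

lemma complex_nth_root_exists:
  assumes "m > 0"
  shows "\<exists>z :: complex. z ^ m = w"
proof
  show "rcis (root m (cmod w)) (Arg w / m) ^ m = w"
    using assms by (simp add: DeMoivre2 rcis_cmod_Arg)
qed

text \<open>Units are adjoined one at a time; Euler's theorem provides a power that falls back into
  \<open>H\<close>. As \<open>H\<close> is a union of residue classes, progress is measured by the
  units below \<open>n\<close> outside \<open>H\<close>.\<close>

lemma partial_char_extend:
  assumes "partial_char n H \<chi>" "n > 0"
  shows "\<exists>\<chi>'. partial_char n {x. coprime x n} \<chi>' \<and> (\<forall>x\<in>H. \<chi>' x = \<chi> x)"
  using assms
proof (induction "card ({x. x < n \<and> coprime x n} - H)" arbitrary: H \<chi> rule: less_induct)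
  case less
  note pc = less.prems(1)
  show ?case
  proof (cases "H = {x. coprime x n}")
    case True
    then show ?thesis using pc by blast
  next
    case False
    then obtain g where g: "coprime g n" "g \<notin> H" using partial_char_coprime[OF pc] by blast
    define m where "m = (LEAST m. m > 0 \<and> g ^ m \<in> H)"
    have "[g ^ totient n = 1] (mod n)" using euler_theorem[OF g(1)] .
    then have "totient n > 0 \<and> g ^ totient n \<in> H"
      using less.prems(2) partial_char_cong(1)[OF pc partial_char_one(1)[OF pc]] cong_sym by simp blast
    then have m: "m > 0" "g ^ m \<in> H"
      unfolding m_def using LeastI[of "\<lambda>m. m > 0 \<and> g ^ m \<in> H"] by blast+
    have least: "g ^ r \<notin> H" if "0 < r" "r < m" for r
      using that not_less_Least unfolding m_def by blast
    obtain z where "z ^ m = \<chi> (g ^ m)" using complex_nth_root_exists[OF m(1)] by blast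
    then obtain H' \<chi>' where H': "partial_char n H' \<chi>'" "H \<subseteq> H'" "g \<in> H'" "\<forall>x\<in>H. \<chi>' x = \<chi> x"
      using partial_char_extend_one[OF pc less.prems(2) g(1) m least] by metis
    have gm: "[g = g mod n] (mod n)" by (simp add: cong_def)
    have "g mod n \<in> H'" "g mod n \<notin> H"
      using partial_char_cong(1)[OF H'(1,3) gm] partial_char_cong(1)[OF pc _ cong_sym[OF gm]] g(2) by blast+
    moreover have "coprime (g mod n) n" using cong_imp_coprime[OF gm g(1)] .
    ultimately have "card ({x. x < n \<and> coprime x n} - H') < card ({x. x < n \<and> coprime x n} - H)"
      using H'(2) less.prems(2) by (intro psubset_card_mono) auto
    from less.hyps[OF this H'(1) less.prems(2)] H'(2,4) show ?thesis by (metis subsetD)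
  qed
qed

section \<open>Characters modulo n and orthogonality\<close>

definition dchars :: "nat \<Rightarrow> (nat \<Rightarrow> complex) set" where
  "dchars n = {\<chi>. (\<forall>a b. \<chi> (a * b) = \<chi> a * \<chi> b) \<and> (\<forall>a. \<chi> (a + n) = \<chi> a) \<and>
     (\<forall>a. \<chi> a = 0 \<longleftrightarrow> \<not> coprime a n)}"

definition dchar0 :: "nat \<Rightarrow> nat \<Rightarrow> complex" where
  "dchar0 n a = (if coprime a n then 1 else 0)"

lemma dchars_separate:
  assumes n: "n > 0" and c: "coprime c n" "\<not> [c = 1] (mod n)"
  shows "\<exists>\<chi>\<in>dchars n. \<chi> c \<noteq> 1"
proof -
  define H where "H = {x. [x = 1] (mod n)}"
  have pc: "partial_char n H (\<lambda>_. 1)"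
    unfolding partial_char_def
  proof (intro conjI ballI allI impI)
    show "1 \<in> H" by (simp add: H_def)
    show "coprime x n" if "x \<in> H" for x
      using that unfolding H_def by (metis cong_imp_coprime cong_sym coprime_1_left mem_Collect_eq)
    show "x * y \<in> H" if "x \<in> H" "y \<in> H" for x y
      using that cong_mult[of x 1 n y 1] by (simp add: H_def)
    show "y \<in> H" if "x \<in> H" "[x = y] (mod n)" for x y
      using that unfolding H_def by (metis cong_sym cong_trans mem_Collect_eq)
  qed auto
  \<comment> \<open>Over the class of 1 the extension only asks for \<open>z ^ m = 1\<close>. As
    \<open>m > 1\<close>, a primitive \<open>m\<close>-th root of unity is an admissible value at
    \<open>c\<close> other than 1.\<close>
  define m where "m = ord n c"
  have m: "m > 0" using c(1) by (simp add: m_def coprime_commute)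
  have m1: "m \<noteq> 1" using c(2) by (simp add: m_def ord_eq_Suc_0_iff)
  have gm: "c ^ m \<in> H" using ord[of c n] by (simp add: H_def m_def)
  have least: "c ^ r \<notin> H" if "0 < r" "r < m" for r
    using that ord_minimal[of r n c] by (simp add: H_def m_def)
  define z where "z = cis (2 * pi / m)"
  have z: "z ^ m = 1" using m by (simp add: z_def DeMoivre)
  have z1: "z \<noteq> 1"
  proof
    assume "z = 1"
    have "inj_on (\<lambda>k. cis (2 * pi * real k / real m)) {..<m}"
      using bij_betw_roots_unity[OF m] by (simp add: bij_betw_def)
    moreover have "cis (2 * pi * real 0 / real m) = cis (2 * pi * real 1 / real m)"
      using \<open>z = 1\<close> by (simp add: z_def)
    ultimately show False using m m1 unfolding inj_on_def
      by (metis One_nat_def lessThan_iff nat_neq_iff less_one zero_neq_one)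
  qed
  obtain H' \<chi>' where H': "partial_char n H' \<chi>'" "c \<in> H'" "\<chi>' c = z"
    using partial_char_extend_one[OF pc n c(1) m gm least] z by metis
  obtain \<chi> where \<chi>: "partial_char n {x. coprime x n} \<chi>" "\<forall>x\<in>H'. \<chi> x = \<chi>' x"
    using partial_char_extend[OF H'(1) n] by blast
  define \<psi> where "\<psi> = (\<lambda>x. if coprime x n then \<chi> x else 0)"
  have "\<psi> \<in> dchars n"
    unfolding dchars_def
  proof (intro CollectI conjI allI)
    fix a b
    show "\<psi> (a * b) = \<psi> a * \<psi> b"
      using partial_char_mult(2)[OF \<chi>(1), of a b] by (auto simp: \<psi>_def)
    have "[a + n = a] (mod n)" by (simp add: cong_def)
    then show "\<psi> (a + n) = \<psi> a"
      using partial_char_cong(2)[OF \<chi>(1), of "a + n" a] cong_imp_coprime cong_sym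
      by (metis \<psi>_def mem_Collect_eq)
    show "\<psi> a = 0 \<longleftrightarrow> \<not> coprime a n"
      using partial_char_nonzero[OF \<chi>(1), of a] by (auto simp: \<psi>_def)
  qed
  moreover have "\<psi> c \<noteq> 1" using \<chi>(2) H' c(1) z1 by (simp add: \<psi>_def)
  ultimately show ?thesis by blast
qed

lemma
  assumes "\<chi> \<in> dchars n"
  shows dchars_mult: "\<chi> (a * b) = \<chi> a * \<chi> b"
    and dchars_eq_0_iff: "\<chi> a = 0 \<longleftrightarrow> \<not> coprime a n"
    and dchars_mod: "\<chi> (a mod n) = \<chi> a"
proof -
  show "\<chi> (a * b) = \<chi> a * \<chi> b" "\<chi> a = 0 \<longleftrightarrow> \<not> coprime a n"
    using assms by (auto simp: dchars_def)
  have "\<chi> (b + k * n) = \<chi> b" for b k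
  proof (induction k)
    case (Suc k)
    have "\<chi> ((b + k * n) + n) = \<chi> (b + k * n)" using assms unfolding dchars_def by blast
    then show ?case using Suc by (simp add: algebra_simps)
  qed simp
  from this[of "a mod n" "a div n"] show "\<chi> (a mod n) = \<chi> a" by simp
qed

lemma dchars_cong: "\<chi> \<in> dchars n \<Longrightarrow> [a = b] (mod n) \<Longrightarrow> \<chi> a = \<chi> b"
  using dchars_mod[of \<chi> n a] dchars_mod[of \<chi> n b] by (simp add: cong_def)

lemma dchars_one: 
  assumes "\<chi> \<in> dchars n"
  shows "\<chi> 1 = 1"
  using dchars_mult[OF assms, of 1 1] dchars_eq_0_iff[OF assms, of 1] by simp

lemma dchars_power:
  assumes "\<chi> \<in> dchars n"
  shows "\<chi> (a ^ k) = \<chi> a ^ k"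
proof (induction k)
  case 0
  show ?case using dchars_one[OF assms] by simp
next
  case (Suc k)
  then show ?case by (simp add: dchars_mult[OF assms])
qed

lemma dchars_root_of_unity:
  assumes "\<chi> \<in> dchars n" "coprime a n"
  shows "\<chi> a ^ totient n = 1"
  using dchars_cong[OF assms(1) euler_theorem[OF assms(2)]] dchars_one[OF assms(1)]
  by (simp only: dchars_power[OF assms(1)])

lemma dchars_norm:
  assumes "\<chi> \<in> dchars n" "n > 0" "coprime a n"
  shows "norm (\<chi> a) = 1"
proof -
  show ?thesis using power_eq_imp_eq_norm[of "\<chi> a" "totient n" 1] dchars_root_of_unity[OF assms(1,3)] assms(2) by simp
qed

lemma dchars_norm_le:
  assumes "\<chi> \<in> dchars n" "n > 0"
  shows "norm (\<chi> a) \<le> 1"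
  using dchars_norm[OF assms, of a] dchars_eq_0_iff[OF assms(1), of a] by (cases "coprime a n") auto

text \<open>A character is determined by its values below \<open>n\<close>, each of which is 0 or a
  root of unity.\<close>

lemma finite_dchars:
  assumes "n > 0"
  shows "finite (dchars n)"
proof (rule inj_on_finite)
  let ?R = "insert 0 {z :: complex. z ^ totient n = 1}"
  show "inj_on (\<lambda>\<chi>. restrict \<chi> {..<n}) (dchars n)"
  proof (rule inj_onI, rule ext)
    fix \<chi> \<psi> a assume *: "\<chi> \<in> dchars n" "\<psi> \<in> dchars n" "restrict \<chi> {..<n} = restrict \<psi> {..<n}"
    have "\<chi> (a mod n) = \<psi> (a mod n)" using assms fun_cong[OF *(3), of "a mod n"] by simp
    then show "\<chi> a = \<psi> a" using *(1,2) by (simp add: dchars_mod)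
  qed
  show "(\<lambda>\<chi>. restrict \<chi> {..<n}) ` dchars n \<subseteq> (\<Pi>\<^sub>E a\<in>{..<n}. ?R)"
  proof (intro image_subsetI PiE_I)
    show "restrict \<chi> {..<n} a \<in> ?R" if "\<chi> \<in> dchars n" "a \<in> {..<n}" for \<chi> a
      using that dchars_root_of_unity[of \<chi> n a] dchars_eq_0_iff[of \<chi> n a] by auto
  qed auto
  have "finite {z :: complex. z ^ totient n = 1}"
    using assms by (intro finite_roots_unity) (simp add: Suc_le_eq)
  then show "finite (\<Pi>\<^sub>E a\<in>{..<n}. ?R)" by (intro finite_PiE) auto
qed

lemma coprime_add_self_nat: "coprime (a + n) n \<longleftrightarrow> coprime a (n::nat)"
  unfolding coprime_iff_gcd_eq_1 by (simp only: gcd_add1)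

lemma dchar0_in_dchars: "dchar0 n \<in> dchars n"
  unfolding dchars_def dchar0_def by (simp add: coprime_add_self_nat)

lemma dchars_cnj: "\<chi> \<in> dchars n \<Longrightarrow> (\<lambda>a. cnj (\<chi> a)) \<in> dchars n"
  by (auto simp: dchars_def)

lemma dchars_prod: "\<chi> \<in> dchars n \<Longrightarrow> \<psi> \<in> dchars n \<Longrightarrow> (\<lambda>a. \<chi> a * \<psi> a) \<in> dchars n"
  by (auto simp: dchars_def)

text \<open>Multiplication by a unit \<open>c\<close> with \<open>\<chi> c \<noteq> 1\<close>
  permutes the residues, so the sum equals \<open>\<chi> c\<close> times itself.\<close>

lemma dchars_sum_residues:
  assumes \<chi>: "\<chi> \<in> dchars n" "\<chi> \<noteq> dchar0 n" and n: "n > 0"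
  shows "(\<Sum>a<n. \<chi> a) = 0"
proof -
  obtain c where c: "coprime c n" "\<chi> c \<noteq> 1"
    using \<chi>(2) dchars_eq_0_iff[OF \<chi>(1)] unfolding dchar0_def by fastforce
  have inj: "inj_on (\<lambda>a. c * a mod n) {..<n}"
  proof (rule inj_onI)
    fix a b assume ab: "a \<in> {..<n}" "b \<in> {..<n}" "c * a mod n = c * b mod n"
    then have "[a = b] (mod n)"
      using c(1) cong_mult_lcancel_nat[of c n a b] by (simp add: cong_def coprime_commute)
    then show "a = b" using ab by (simp add: cong_def)
  qed
  have "(\<lambda>a. c * a mod n) ` {..<n} = {..<n}"
    using n by (intro endo_inj_surj inj) auto
  then have "(\<Sum>a<n. \<chi> a) = (\<Sum>a<n. \<chi> (c * a mod n))"
    using sum.reindex[OF inj, of \<chi>] by (simp only: o_def)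
  also have "\<dots> = \<chi> c * (\<Sum>a<n. \<chi> a)"
    by (simp add: dchars_mod[OF \<chi>(1)] dchars_mult[OF \<chi>(1)] sum_distrib_left)
  finally show ?thesis using c(2) by simp
qed

lemma dchars_partial_sum_bound:
  assumes \<chi>: "\<chi> \<in> dchars n" "\<chi> \<noteq> dchar0 n" and n: "n > 0"
  shows "norm (\<Sum>a<N. \<chi> a) \<le> n"
proof (induction N rule: less_induct)
  case (less N)
  show ?case
  proof (cases "N < n")
    case True
    have "norm (\<Sum>a<N. \<chi> a) \<le> (\<Sum>a<N. 1)"
      by (intro sum_norm_le dchars_norm_le[OF \<chi>(1) n])
    then show ?thesis using True by simp
  next
    case False
    define M where "M = N - n"
    have N: "N = n + M" using False by (simp add: M_def)
    have "(\<Sum>a<n + M. \<chi> a) = (\<Sum>a<n. \<chi> a) + (\<Sum>a<M. \<chi> (n + a))"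
      by (induction M) simp_all
    also have "(\<Sum>a<M. \<chi> (n + a)) = (\<Sum>a<M. \<chi> a)"
      by (intro sum.cong refl dchars_cong[OF \<chi>(1)]) (simp add: cong_def)
    finally have "(\<Sum>a<N. \<chi> a) = (\<Sum>a<M. \<chi> a)"
      using dchars_sum_residues[OF \<chi> n] N by simp
    moreover have "M < N" using n N by simp
    ultimately show ?thesis using less.IH[of M] by simp
  qed
qed

text \<open>The same trick in the other variable: twisting by a character \<open>\<psi>\<close> with
  \<open>\<psi> c \<noteq> 1\<close> permutes \<open>dchars n\<close>.\<close>

lemma dchars_orthogonality:
  assumes n: "n > 0" and c: "coprime c n"
  shows "(\<Sum>\<chi>\<in>dchars n. \<chi> c) = (if [c = 1] (mod n) then of_nat (card (dchars n)) else 0)"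
proof (cases "[c = 1] (mod n)")
  case True
  have "(\<Sum>\<chi>\<in>dchars n. \<chi> c) = (\<Sum>\<chi>\<in>dchars n. 1)"
    using dchars_cong[OF _ True] dchars_one by (intro sum.cong) metis+
  then show ?thesis using True by simp
next
  case False
  obtain \<psi> where \<psi>: "\<psi> \<in> dchars n" "\<psi> c \<noteq> 1" using dchars_separate[OF n c False] by blast
  let ?f = "\<lambda>\<chi> a. \<psi> a * \<chi> a"
  have inj: "inj_on ?f (dchars n)"
  proof (rule inj_onI, rule ext)
    fix \<chi> \<chi>' a assume *: "\<chi> \<in> dchars n" "\<chi>' \<in> dchars n" "?f \<chi> = ?f \<chi>'"
    show "\<chi> a = \<chi>' a"
      using fun_cong[OF *(3), of a] dchars_eq_0_iff[OF *(1), of a] dchars_eq_0_iff[OF *(2), of a]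
        dchars_eq_0_iff[OF \<psi>(1), of a] by (cases "coprime a n") auto
  qed
  have "?f ` dchars n = dchars n"
    by (intro endo_inj_surj inj finite_dchars n image_subsetI dchars_prod \<psi>(1))
  then have "(\<Sum>\<chi>\<in>dchars n. \<chi> c) = (\<Sum>\<chi>\<in>dchars n. \<psi> c * \<chi> c)"
    using sum.reindex[OF inj, of "\<lambda>\<chi>. \<chi> c"] by (simp only: o_def)
  also have "\<dots> = \<psi> c * (\<Sum>\<chi>\<in>dchars n. \<chi> c)" by (simp add: sum_distrib_left)
  finally show ?thesis using \<psi>(2) False by simp
qed

section \<open>Mangoldt and Moebius sums\<close>

text \<open>Summation by parts. What the boundary terms do not account for is a sum of
  \<open>A (k + 1) * (g k - g (k + 1))\<close>, at most \<open>B * (g m - g N)\<close> by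
  telescoping; the boundary terms add \<open>B * (g N + g m)\<close>.\<close>

lemma abel_summation_bound:
  fixes f :: "nat \<Rightarrow> 'a :: real_normed_field" and g :: "nat \<Rightarrow> real"
  assumes bound: "\<And>N. norm (\<Sum>k<N. f k) \<le> B"
    and dec: "\<And>k. m \<le> k \<Longrightarrow> g (Suc k) \<le> g k" and nonneg: "\<And>k. m \<le> k \<Longrightarrow> 0 \<le> g k"
  shows "norm (\<Sum>k\<in>{m..<N}. f k * of_real (g k)) \<le> 2 * B * g m"
proof (cases "m \<le> N")
  case False
  have "0 \<le> B" using bound[of 0] by simp
  then show ?thesis using False nonneg[of m] by simp
next
  case True
  define A where "A N = (\<Sum>k<N. f k)" for N
  have "norm ((\<Sum>k\<in>{m..<N}. f k * of_real (g k)) - (A N * of_real (g N) - A m * of_real (g m)))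
      \<le> B * (g m - g N)"
    using True
  proof (induction N rule: dec_induct)
    case (step N)
    let ?S = "\<lambda>N. (\<Sum>k\<in>{m..<N}. f k * of_real (g k)) - (A N * of_real (g N) - A m * of_real (g m))"
    have "?S (Suc N) = ?S N + A (Suc N) * of_real (g N - g (Suc N))"
      using step.hyps by (simp add: A_def algebra_simps)
    also have "norm \<dots> \<le> norm (?S N) + norm (A (Suc N)) * (g N - g (Suc N))"
      using norm_triangle_ineq[of "?S N" "A (Suc N) * of_real (g N - g (Suc N))"] dec[of N] step.hyps
      by (simp add: norm_mult del: of_real_diff)
    also have "\<dots> \<le> B * (g m - g N) + B * (g N - g (Suc N))"
      using step.IH bound[of "Suc N"] dec[of N] step.hyps unfolding A_def
      by (intro add_mono mult_right_mono) auto
    finally show ?case by (simp add: algebra_simps)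
  qed simp
  moreover have "norm (A N * of_real (g N) - A m * of_real (g m)) \<le> B * g N + B * g m"
    using bound[of N] bound[of m] nonneg[of N] nonneg[of m] True unfolding A_def
    by (intro order.trans[OF norm_triangle_ineq4] add_mono) (auto simp: norm_mult intro: mult_right_mono)
  ultimately have "norm (\<Sum>k\<in>{m..<N}. f k * of_real (g k)) \<le> B * (g m - g N) + (B * g N + B * g m)"
    using norm_triangle_sub[of "\<Sum>k\<in>{m..<N}. f k * of_real (g k)" "A N * of_real (g N) - A m * of_real (g m)"]
    by linarith
  then show ?thesis by (simp add: algebra_simps)
qed

text \<open>A pair of \<open>k \<le> x\<close> and a divisor \<open>d\<close> corresponds to
  \<open>d\<close> and its cofactor \<open>m\<close>. This turns every divisor convolution below
  into a nested sum.\<close>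

lemma sum_divisors_interchange:
  fixes F :: "nat \<Rightarrow> nat \<Rightarrow> 'a :: comm_monoid_add"
  shows "(\<Sum>k=1..x. \<Sum>d | d dvd k. F d (k div d)) = (\<Sum>d=1..x. \<Sum>m=1..x div d. F d m)"
proof -
  have "(\<Sum>k=1..x. \<Sum>d | d dvd k. F d (k div d)) =
      (\<Sum>(k, d)\<in>(SIGMA k:{1..x}. {d. d dvd k}). F d (k div d))"
    by (rule sum.Sigma) auto
  also have "\<dots> = (\<Sum>(d, m)\<in>(SIGMA d:{1..x}. {1..x div d}). F d m)"
  proof (rule sum.reindex_bij_witness[of _ "\<lambda>(d, m). (d * m, d)" "\<lambda>(k, d). (d, k div d)"]; clarsimp)
    fix k d assume k: "Suc 0 \<le> k" "k \<le> x" "d dvd k"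
    have "d \<noteq> 0" using k by (intro notI) auto
    then show "Suc 0 \<le> d \<and> d \<le> x \<and> Suc 0 \<le> k div d \<and> k div d \<le> x div d"
      using k dvd_imp_le[of d k] by (auto simp: Suc_le_eq div_le_mono div_greater_zero_iff)
  next
    fix d m assume "Suc 0 \<le> d" "d \<le> x" "Suc 0 \<le> m" "m \<le> x div d"
    then show "d * m \<le> x"
      by (metis div_times_less_eq_dividend mult.commute mult_le_mono1 order_trans)
  qed
  also have "\<dots> = (\<Sum>d=1..x. \<Sum>m=1..x div d. F d m)"
    by (rule sum.Sigma[symmetric]) auto
  finally show ?thesis .
qed

section \<open>Chebyshev and Mertens bounds\<close>

lemma ln_fact_eq_sum: "ln (fact x :: real) = (\<Sum>k=1..x. ln (real k))"
proof (induction x)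
  case (Suc x)
  have "ln (fact (Suc x) :: real) = ln (real (Suc x)) + ln (fact x)"
    unfolding fact_Suc by (subst ln_mult_pos) auto
  then show ?case using Suc by simp
qed simp

text \<open>Chebyshev's identity: write each \<open>ln k\<close> as a sum of \<open>mangoldt\<close>
  over divisors and count the multiples of \<open>d\<close>. Both the Chebyshev and the Mertens
  bounds come from it.\<close>

lemma mangoldt_floor_sum: "(\<Sum>d=1..x. mangoldt d * real (x div d)) = ln (fact x)"
proof -
  have "ln (fact x) = (\<Sum>k=1..x. \<Sum>d | d dvd k. mangoldt d :: real)"
    unfolding ln_fact_eq_sum by (intro sum.cong refl, subst mangoldt_sum) auto
  also have "\<dots> = (\<Sum>d=1..x. \<Sum>m=1..x div d. mangoldt d)"
    by (rule sum_divisors_interchange)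
  finally show ?thesis by (simp add: mult.commute)
qed

lemma ln_fact_le: "ln (fact x :: real) \<le> x * ln x"
proof -
  have "(\<Sum>k=1..x. ln (real k)) \<le> (\<Sum>k=1..x. ln (real x))"
    by (intro sum_mono) auto
  then show ?thesis by (simp add: ln_fact_eq_sum)
qed

lemma ln_fact_ge: "ln (fact x :: real) \<ge> x * ln x - x"
proof (induction x)
  case (Suc x)
  show ?case
  proof (cases "x = 0")
    case False
    have "real (Suc x) = real x * (1 + 1 / x)"
      using False by (simp add: field_simps)
    then have "ln (real (Suc x)) = ln (real x * (1 + 1 / x))" by (simp only:)
    also have "\<dots> = ln x + ln (1 + 1 / real x)"
      using False by (subst ln_mult_pos) (auto simp: field_simps)
    also have "ln (1 + 1 / real x) \<le> 1 / x" by (rule ln_add_one_self_le_self) simp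
    finally have "x * ln (real (Suc x)) \<le> x * (ln x + 1 / x)"
      by (intro mult_left_mono) auto
    also have "\<dots> = x * ln x + 1" using False by (simp add: field_simps)
    finally have "x * ln (real (Suc x)) \<le> x * ln x + 1" .
    moreover have "ln (fact (Suc x) :: real) = ln (real (Suc x)) + ln (fact x)"
      unfolding ln_fact_eq_sum by simp
    ultimately show ?thesis using Suc by (simp add: algebra_simps del: fact_Suc)
  qed simp
qed simp

text \<open>In other terms, the central binomial coefficient is at most
  \<open>4 ^ n\<close>.\<close>

lemma fact_double_le: "fact (2 * n) \<le> (4 ^ n * fact n ^ 2 :: real)"
proof (induction n)
  case (Suc n)
  have "fact (2 * Suc n) = (real (2 * n + 2) * real (2 * n + 1)) * fact (2 * n)"
    by (simp add: algebra_simps)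
  also have "\<dots> \<le> (4 * real (Suc n) ^ 2) * (4 ^ n * fact n ^ 2)"
  proof (rule mult_mono[OF _ Suc])
    show "real (2 * n + 2) * real (2 * n + 1) \<le> 4 * real (Suc n) ^ 2"
      by (simp add: power2_eq_square algebra_simps)
  qed auto
  also have "\<dots> = 4 ^ Suc n * fact (Suc n) ^ 2"
    by (simp add: power_mult_distrib)
  finally show ?case .
qed simp

text \<open>In the logarithm of the central binomial coefficient, \<open>mangoldt d\<close> has the
  coefficient \<open>2 * n div d - 2 * (n div d)\<close>. It is never negative, and it is at least 1
  for \<open>n < d \<le> 2 * n\<close>.\<close>

lemma mangoldt_sum_dyadic:
  "(\<Sum>k=1..2 * n. mangoldt k :: real) \<le> (\<Sum>k=1..n. mangoldt k) + 2 * n"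
proof -
  have "(\<Sum>d=1..n. mangoldt d * real (n div d)) = (\<Sum>d=1..2 * n. mangoldt d * real (n div d))"
    by (intro sum.mono_neutral_left) auto
  then have eq: "ln (fact (2 * n)) - 2 * ln (fact n) =
      (\<Sum>d=1..2 * n. mangoldt d * (real (2 * n div d) - 2 * real (n div d)))"
    unfolding mangoldt_floor_sum[symmetric] by (simp add: sum_subtractf sum_distrib_left algebra_simps)
  have "(\<Sum>k=1..2 * n. mangoldt k) = (\<Sum>k=1..n. mangoldt k) + (\<Sum>k=n + 1..2 * n. mangoldt k :: real)"
    by (subst sum.union_disjoint[symmetric]) (auto intro!: sum.cong)
  also have "(\<Sum>k=n + 1..2 * n. mangoldt k) = (\<Sum>d=1..2 * n. if d > n then mangoldt d else 0 :: real)"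
    by (intro sum.mono_neutral_cong_left) auto
  also have "\<dots> \<le> (\<Sum>d=1..2 * n. mangoldt d * (real (2 * n div d) - 2 * real (n div d)))"
  proof (intro sum_mono)
    fix d assume d: "d \<in> {1..2 * n}"
    have "2 * (n div d) \<le> 2 * n div d"
      using d by (subst less_eq_div_iff_mult_less_eq) (auto simp: div_times_less_eq_dividend)
    moreover have "1 \<le> 2 * n div d" using d by (auto simp: less_eq_div_iff_mult_less_eq)
    ultimately show "(if d > n then mangoldt d else 0) \<le> mangoldt d * (real (2 * n div d) - 2 * real (n div d))"
      using mangoldt_nonneg[of d] mult_left_mono[of 1 "real (2 * n div d) - 2 * real (n div d)" "mangoldt d"]
      by auto
  qed
  also have "\<dots> \<le> 2 * n"
  proof -
    have "ln (fact (2 * n) :: real) \<le> ln (4 ^ n * fact n ^ 2)"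
      using fact_double_le[of n] by (subst ln_le_cancel_iff) auto
    also have "\<dots> = n * ln 4 + 2 * ln (fact n)"
      by (simp add: ln_mult_pos ln_realpow)
    also have "ln (4 :: real) = 2 * ln 2" using ln_realpow[of "2::real" 2] by simp
    also have "n * (2 * ln 2) \<le> real n * (2 * 1)"
      using ln_2_less_1 by (intro mult_left_mono) auto
    finally show ?thesis unfolding eq[symmetric] by simp
  qed
  finally show ?thesis by simp
qed

lemma chebyshev_psi_le: "(\<Sum>k=1..x. mangoldt k :: real) \<le> 4 * x"
proof (induction x rule: less_induct)
  case (less x)
  show ?case
  proof (cases "x \<le> 1")
    case True
    then show ?thesis by (cases x) auto
  next
    case False
    define n where "n = (x + 1) div 2"
    have n: "x \<le> 2 * n" "2 * n \<le> x + 1" "n < x" using False unfolding n_def by auto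
    have "(\<Sum>k=1..x. mangoldt k :: real) \<le> (\<Sum>k=1..2 * n. mangoldt k)"
      using n by (intro sum_mono2) (auto simp: mangoldt_nonneg)
    also have "\<dots> \<le> 4 * n + 2 * n" using mangoldt_sum_dyadic[of n] less.IH[OF n(3)] by linarith
    \<comment> \<open>Adding \<open>4 * n \<le> 2 * x + 2\<close> and
      \<open>2 * n \<le> 2 * x - 2\<close> gives exactly \<open>6 * n \<le> 4 * x\<close>.\<close>
    finally show ?thesis using n False by linarith
  qed
qed

text \<open>Divide \<open>mangoldt_floor_sum\<close> by \<open>x\<close>. Replacing the floors by
  \<open>x / k\<close> costs at most the Chebyshev sum over \<open>x\<close>, hence 4.\<close>

lemma mangoldt_over_sum_upper: 
  assumes "x > 0"
  shows "(\<Sum>k=1..x. mangoldt k / real k) \<le> ln x + 4"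
proof -
  have "x * (\<Sum>k=1..x. mangoldt k / real k) = (\<Sum>k=1..x. mangoldt k * (real x / real k))"
    by (simp add: sum_distrib_left algebra_simps)
  also have "\<dots> \<le> (\<Sum>k=1..x. mangoldt k * (real (x div k) + 1))"
  proof (intro sum_mono mult_left_mono mangoldt_nonneg)
    fix k show "real x / real k \<le> real (x div k) + 1"
      using floor_divide_of_nat_eq[of x k, where ?'a = real] by linarith
  qed
  also have "\<dots> = (\<Sum>k=1..x. mangoldt k * real (x div k)) + (\<Sum>k=1..x. mangoldt k)"
    by (simp add: algebra_simps sum.distrib)
  also have "\<dots> \<le> x * ln x + 4 * x"
    unfolding mangoldt_floor_sum using ln_fact_le chebyshev_psi_le by (intro add_mono)
  also have "\<dots> = x * (ln x + 4)" by (simp add: algebra_simps)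
  finally show ?thesis using assms by simp
qed

lemma mangoldt_over_sum_lower: 
  assumes "x > 0"
  shows "ln x - 1 \<le> (\<Sum>k=1..x. mangoldt k / real k)"
proof -
  have "x * (ln x - 1) \<le> (\<Sum>k=1..x. mangoldt k * real (x div k))"
    unfolding mangoldt_floor_sum using ln_fact_ge[of x] by (simp add: algebra_simps)
  also have "\<dots> \<le> (\<Sum>k=1..x. mangoldt k * (real x / real k))"
    by (intro sum_mono mult_left_mono mangoldt_nonneg of_nat_div_le_of_nat)
  also have "\<dots> = x * (\<Sum>k=1..x. mangoldt k / real k)"
    by (simp add: sum_distrib_left algebra_simps)
  finally show ?thesis using assms by simp
qed

section \<open>The Moebius function\<close>

definition mu :: "nat \<Rightarrow> real" where
  "mu n = (if squarefree n then (-1) ^ card (prime_factors n) else 0)"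

lemma abs_mu_le: "\<bar>mu n\<bar> \<le> 1"
  by (simp add: mu_def minus_one_power_iff)

lemma mu_prime_mult:
  assumes "prime p" "\<not> p dvd d" "d > 0"
  shows "mu (p * d) = - mu d"
proof -
  have cop: "coprime p d" using assms prime_imp_coprime by blast
  have "squarefree (p * d) \<longleftrightarrow> squarefree d"
    using assms cop by (auto simp: squarefree_mult_coprime squarefree_prime dest: squarefree_multD)
  moreover have "prime_factors (p * d) = insert p (prime_factors d)"
    using assms by (auto simp: prime_factors_product prime_factorization_prime)
  moreover have "p \<notin> prime_factors d" using assms by auto
  ultimately show ?thesis by (simp add: mu_def)
qed

text \<open>Fix a prime \<open>p\<close> dividing \<open>n\<close>. The squarefree divisors pair off
  as \<open>d\<close> and \<open>p * d\<close>, with opposite signs.\<close>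

lemma mu_sum_divisors:
  assumes "n > 0"
  shows "(\<Sum>d | d dvd n. mu d) = (if n = 1 then 1 else 0)"
proof (cases "n = 1")
  case True
  then show ?thesis by (simp add: mu_def)
next
  case False
  then obtain p where p: "prime p" "p dvd n" using prime_factor_nat by blast
  let ?D = "{d. d dvd n \<and> squarefree d \<and> \<not> p dvd d}"
  let ?E = "{d. d dvd n \<and> squarefree d \<and> p dvd d}"
  have fin: "finite {d. d dvd n}" using assms by simp
  have "(\<Sum>d | d dvd n. mu d) = (\<Sum>d\<in>?D \<union> ?E. mu d)"
    using fin by (intro sum.mono_neutral_right) (auto simp: mu_def)
  also have "\<dots> = (\<Sum>d\<in>?D. mu d) + (\<Sum>d\<in>?E. mu d)"
    using fin by (intro sum.union_disjoint) (auto elim: finite_subset[rotated])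
  also have "(\<Sum>d\<in>?E. mu d) = (\<Sum>d\<in>?D. mu (p * d))"
  proof (rule sum.reindex_bij_witness[of _ "\<lambda>d. p * d" "\<lambda>d. d div p"])
    fix d assume "d \<in> ?E"
    then obtain e where e: "d = p * e" "squarefree d" "d dvd n" by auto
    have p0: "p \<noteq> 0" using p(1) by auto
    have "\<not> p dvd e"
      using e p(1) squarefreeD[of d p] by (auto simp: power2_eq_square elim!: dvdE)
    moreover have "squarefree e" using e squarefree_multD(2)[of p e] by simp
    moreover have "e dvd n" using e by (metis dvd_mult_left mult.commute)
    ultimately show "p * (d div p) = d" "d div p \<in> ?D" using e p0 by auto
    show "mu (p * (d div p)) = mu d" using e p0 by simp
  next
    fix d assume d: "d \<in> ?D"
    have "coprime p d" using d p(1) prime_imp_coprime by blast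
    then show "p * d \<in> ?E"
      using d p by (auto simp: squarefree_mult_coprime squarefree_prime intro: divides_mult)
    show "p * d div p = d" using p(1) by auto
  qed
  also have "\<dots> = (\<Sum>d\<in>?D. - mu d)"
    using assms p(1) by (intro sum.cong refl mu_prime_mult) (auto intro: dvd_pos_nat)
  finally show ?thesis using False by (simp add: sum_negf)
qed

text \<open>Split \<open>ln (x / d)\<close> into \<open>ln x - ln k\<close> and
  \<open>ln (k / d)\<close>. The first part survives only for \<open>k = 1\<close>; the second is
  Moebius inversion of \<open>mangoldt_sum\<close>. The free \<open>x\<close> lets the identity
  detect a vanishing L-value.\<close>

lemma mu_ln_sum_divisors:
  assumes k: "k > 0" and x: "x > (0::real)"
  shows "(\<Sum>d | d dvd k. mu d * ln (x / d)) = (if k = 1 then ln x else 0) + mangoldt k"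
proof -
  have fin: "finite {d. d dvd k}" using k by simp
  have "(\<Sum>d | d dvd k. mu d * ln (x / d)) =
      (\<Sum>d | d dvd k. mu d * (ln x - ln k) + mu d * ln (real (k div d)))"
  proof (intro sum.cong refl)
    fix d assume "d \<in> {d. d dvd k}"
    then obtain e where e: "k = d * e" by auto
    have "d > 0" "e > 0" using e k by auto
    then show "mu d * ln (x / d) = mu d * (ln x - ln k) + mu d * ln (real (k div d))"
      using x e by (simp add: ln_div ln_mult_pos algebra_simps)
  qed
  also have "\<dots> = (\<Sum>d | d dvd k. mu d) * (ln x - ln k) + (\<Sum>d | d dvd k. mu d * ln (real (k div d)))"
    by (simp add: sum.distrib sum_distrib_right)
  also have "(\<Sum>d | d dvd k. mu d) * (ln x - ln k) = (if k = 1 then ln x else 0)"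
    using mu_sum_divisors[OF k] by simp
  also have "(\<Sum>d | d dvd k. mu d * ln (real (k div d))) =
      (\<Sum>d | d dvd k. \<Sum>e | e dvd k div d. mu d * mangoldt e)"
  proof (intro sum.cong refl)
    fix d assume "d \<in> {d. d dvd k}"
    then have "k div d \<noteq> 0" using k by (auto elim!: dvdE)
    then show "mu d * ln (real (k div d)) = (\<Sum>e | e dvd k div d. mu d * mangoldt e)"
      using mangoldt_sum[of "k div d", where ?'a = real] by (simp flip: sum_distrib_left)
  qed
  also have "\<dots> = (\<Sum>(d, e)\<in>(SIGMA d:{d. d dvd k}. {e. e dvd k div d}). mu d * mangoldt e)"
    using fin k by (intro sum.Sigma) (auto elim!: dvdE)
  also have "\<dots> = (\<Sum>(e, d)\<in>(SIGMA e:{e. e dvd k}. {d. d dvd k div e}). mu d * mangoldt e)"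
  proof -
    have *: "b dvd k \<and> a dvd k div b" if ab: "a dvd k" "b dvd k div a" for a b
    proof -
      obtain c where c: "k = a * c" using ab(1) by (auto elim: dvdE)
      then have "a \<noteq> 0" using k by auto
      then obtain c' where c': "k = a * (b * c')" using ab(2) c by auto
      then have "b \<noteq> 0" using k by auto
      then show ?thesis using c' by (simp add: mult.left_commute[of a b])
    qed
    show ?thesis
      by (rule sum.reindex_bij_witness[of _ prod.swap prod.swap]; clarsimp) (use * in blast)+
  qed
  also have "\<dots> = (\<Sum>e | e dvd k. \<Sum>d | d dvd k div e. mu d * mangoldt e)"
    using fin k by (intro sum.Sigma[symmetric]) (auto elim!: dvdE)
  also have "\<dots> = (\<Sum>e | e dvd k. if e = k then mangoldt e else 0)"
  proof (intro sum.cong refl)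
    fix e assume "e \<in> {e. e dvd k}"
    then obtain c where c: "k = e * c" by auto
    have "e > 0" "c > 0" using c k by auto
    then have "(\<Sum>d | d dvd k div e. mu d) = (if e = k then 1 else 0)"
      using mu_sum_divisors[of c] c by simp
    then show "(\<Sum>d | d dvd k div e. mu d * mangoldt e) = (if e = k then mangoldt e else 0)"
      by (simp flip: sum_distrib_right)
  qed
  also have "\<dots> = mangoldt k" using fin by (subst sum.delta) auto
  finally show ?thesis .
qed

text \<open>Only proper prime powers contribute. For each \<open>p\<close> the geometric series from
  exponent 2 on is at most \<open>2 / p ^ 2\<close>, and \<open>ln p \<le> 2 * sqrt p\<close> makes
  the total summable.\<close>

lemma mangoldt_over_nonprime_bounded:
  "\<exists>C. \<forall>x. (\<Sum>k | k \<in> {1..x} \<and> \<not> prime k. mangoldt k / real k) \<le> C"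
proof -
  have summ: "summable (\<lambda>p. 4 * real p powr (-3/2))"
    by (intro summable_mult) (subst summable_real_powr_iff, simp)
  show ?thesis
  proof (intro exI allI)
    fix x :: nat
    let ?P = "{p. prime p \<and> p \<in> {2..x}}"
    let ?h = "\<lambda>(p, j). (p ^ j :: nat)"
    have "(\<Sum>k | k \<in> {1..x} \<and> \<not> prime k. mangoldt k / real k) =
        (\<Sum>k | k \<in> {1..x} \<and> \<not> prime k \<and> primepow k. mangoldt k / real k)"
      by (intro sum.mono_neutral_right) (auto simp: mangoldt_def)
    also have "\<dots> \<le> (\<Sum>k\<in>?h ` (?P \<times> {2..x}). mangoldt k / real k)"
    proof (intro sum_mono2 subsetI)
      fix k assume k: "k \<in> {k. k \<in> {1..x} \<and> \<not> prime k \<and> primepow k}"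
      then obtain p j where pj: "prime p" "j > 0" "k = p ^ j" unfolding primepow_def by auto
      have p2: "p \<ge> 2" using pj(1) prime_ge_2_nat by blast
      have "j \<noteq> 1" using k pj by auto
      then have j: "j \<ge> 2" using pj(2) by linarith
      have "p \<le> p ^ j" using p2 pj(2) by (simp add: self_le_power)
      moreover have "j < p ^ j" using p2 by (simp add: less_exp power_gt_expt)
      ultimately show "k \<in> ?h ` (?P \<times> {2..x})" using k pj p2 j by (intro image_eqI[of _ _ "(p, j)"]) auto
    qed (auto simp: mangoldt_nonneg)
    also have "\<dots> \<le> (\<Sum>(p, j)\<in>?P \<times> {2..x}. mangoldt (p ^ j) / real (p ^ j))"
      using sum_image_le[of "?P \<times> {2..x}" "\<lambda>k. mangoldt k / real k" ?h]
      by (simp add: mangoldt_nonneg case_prod_beta o_def del: of_nat_power)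
    also have "\<dots> = (\<Sum>p\<in>?P. \<Sum>j=2..x. mangoldt (p ^ j) / real (p ^ j))"
      by (rule sum.cartesian_product[symmetric])
    also have "\<dots> \<le> (\<Sum>p\<in>?P. 4 * real p powr (-3/2))"
    proof (intro sum_mono)
      fix p assume p: "p \<in> ?P"
      have p2: "real p \<ge> 2" using p by auto
      have tail: "(\<Sum>j=2..n. (1 / real p) ^ j) \<le> 2 / p ^ 2" for n
      proof -
        \<comment> \<open>The subtracted term is the exact tail beyond \<open>n\<close>; with it the
          bound becomes inductive.\<close>
        have "(\<Sum>j=2..n. (1 / real p) ^ j) \<le> 2 / p ^ 2 - (1 / real p) ^ n / (p - 1)" if "n \<ge> 1"
          using that
        proof (induction n rule: dec_induct)
          case base
          then show ?case using p2 by (simp add: field_simps power2_eq_square)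
        next
          case (step n)
          have "(1 / real p) ^ Suc n - (1 / real p) ^ n / (p - 1) = - ((1 / real p) ^ Suc n / (p - 1))"
            using p2 by (simp add: field_simps)
          then show ?case using step by simp
        qed
        then show ?thesis using p2 by (cases "n \<ge> 1") (auto intro: order.trans)
      qed
      have "ln (real p) / 2 = ln (sqrt p)" using p2 by (simp add: ln_sqrt)
      also have "\<dots> \<le> sqrt p - 1" using p2 by (intro ln_le_minus_one) auto
      finally have lnp: "ln (real p) \<le> 2 * p powr (1/2)" using p2 by (simp add: powr_half_sqrt)
      have "(\<Sum>j=2..x. mangoldt (p ^ j) / real (p ^ j)) = (\<Sum>j=2..x. ln (real p) * (1 / real p) ^ j)"
        using p by (intro sum.cong) (auto simp: power_one_over)
      also have "\<dots> = ln (real p) * (\<Sum>j=2..x. (1 / real p) ^ j)"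
        by (simp add: sum_distrib_left)
      also have "\<dots> \<le> (2 * p powr (1/2)) * (2 * p powr (-2))"
        using tail[of x] lnp p2 by (intro mult_mono) (auto simp: powr_minus_divide powr_numeral sum_nonneg)
      also have "\<dots> = 4 * real p powr (-3/2)" by (simp flip: powr_add)
      finally show "(\<Sum>j=2..x. mangoldt (p ^ j) / real (p ^ j)) \<le> 4 * real p powr (-3/2)" .
    qed
    also have "\<dots> \<le> (\<Sum>p. 4 * real p powr (-3/2))"
      by (intro sum_le_suminf summ) auto
    finally show "(\<Sum>k | k \<in> {1..x} \<and> \<not> prime k. mangoldt k / real k) \<le> (\<Sum>p. 4 * real p powr (-3/2))" .
  qed
qed

section \<open>Real characters\<close>

lemma sum_divisors_prime_power_mult:
  fixes c :: "nat \<Rightarrow> real"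
  assumes mult: "\<And>a b. c (a * b) = c a * c b" and one: "c 1 = 1"
    and p: "prime p" "\<not> p dvd m" and m: "m > 0"
  shows "(\<Sum>d | d dvd p ^ k * m. c d) = (\<Sum>i\<le>k. c p ^ i) * (\<Sum>d | d dvd m. c d)"
proof -
  have pow: "c (p ^ i) = c p ^ i" for i using one by (induction i) (simp_all add: mult)
  have "bij_betw (\<lambda>(i, d). p ^ i * d) ({..k} \<times> {d. d dvd m}) {d. d dvd p ^ k * m}"
  proof (rule bij_betw_imageI)
    have mlt: "multiplicity p (p ^ l * f) = l" if "f dvd m" for l f
    proof -
      have "f \<noteq> 0" "\<not> p dvd f" using that p(2) m by (auto intro: dvd_trans)
      then show ?thesis using p(1)
        by (subst prime_elem_multiplicity_mult_distrib) (auto simp: not_dvd_imp_multiplicity_0)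
    qed
    show "inj_on (\<lambda>(i, d). p ^ i * d) ({..k} \<times> {d. d dvd m})"
    proof (rule inj_onI, clarify)
      fix i d j e assume *: "d dvd m" "e dvd m" "p ^ i * d = p ^ j * e"
      have "i = j" using mlt[of d i] mlt[of e j] * by simp
      then show "i = j \<and> d = e" using * p(1) by auto
    qed
    have "x \<in> (\<lambda>(i, d). p ^ i * d) ` ({..k} \<times> {d. d dvd m})" if x: "x dvd p ^ k * m" for x
    proof -
      obtain b c where bc: "x = b * c" "b dvd p ^ k" "c dvd m" using division_decomp[OF x] by blast
      then obtain i where "i \<le> k" "b = p ^ i" using divides_primepow_nat[OF p(1)] by blast
      then show ?thesis using bc by auto
    qed
    moreover have "p ^ i * d dvd p ^ k * m" if "i \<le> k" "d dvd m" for i d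
      using that by (intro mult_dvd_mono le_imp_power_dvd)
    ultimately show "(\<lambda>(i, d). p ^ i * d) ` ({..k} \<times> {d. d dvd m}) = {d. d dvd p ^ k * m}"
      by auto
  qed
  from sum.reindex_bij_betw[OF this, of c, symmetric]
  have "(\<Sum>d | d dvd p ^ k * m. c d) = (\<Sum>(i, d)\<in>{..k} \<times> {d. d dvd m}. c (p ^ i * d))"
    by (simp add: case_prod_beta)
  also have "\<dots> = (\<Sum>(i, d)\<in>{..k} \<times> {d. d dvd m}. c p ^ i * c d)" by (simp add: mult pow)
  also have "\<dots> = (\<Sum>i\<le>k. c p ^ i) * (\<Sum>d | d dvd m. c d)"
    by (simp add: sum_product sum.cartesian_product)
  finally show ?thesis .
qed

lemma power_sum_sign:
  fixes x :: real
  assumes "x \<in> {-1, 0, 1}"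
  shows "(\<Sum>i\<le>k. x ^ i) \<ge> (if even k then 1 else 0)"
proof -
  have "(\<Sum>i\<le>k. (-1 :: real) ^ i) = (if even k then 1 else 0)" by (induction k) auto
  moreover have "(\<Sum>i\<le>k. (0 :: real) ^ i) = 1" by (induction k) auto
  ultimately show ?thesis using assms by auto
qed

text \<open>By multiplicativity only the sums over powers of one prime matter. For
  \<open>c p = -1\<close> they alternate between 1 and 0, otherwise they are at least 1; even
  exponents, as in a square, always give at least 1.\<close>

lemma
  fixes c :: "nat \<Rightarrow> real"
  assumes mult: "\<And>a b. c (a * b) = c a * c b" and one: "c 1 = 1"
    and vals: "\<And>a. c a \<in> {-1, 0, 1}"
  shows sum_divisors_real_character_nonneg: "m > 0 \<Longrightarrow> (\<Sum>d | d dvd m. c d) \<ge> 0"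
    and sum_divisors_real_character_square: "m > 0 \<Longrightarrow> (\<Sum>d | d dvd m ^ 2. c d) \<ge> 1"
proof -
  have "m > 0 \<Longrightarrow> (\<Sum>d | d dvd m. c d) \<ge> 0 \<and> (\<Sum>d | d dvd m ^ 2. c d) \<ge> 1"
  proof (induction m rule: less_induct)
    case (less m)
    show ?case
    proof (cases "m = 1")
      case True
      then show ?thesis using one by simp
    next
      case False
      then obtain p where p: "prime p" "p dvd m" using prime_factor_nat by blast
      define k where "k = multiplicity p m"
      obtain m' where m': "m = p ^ k * m'" "\<not> p dvd m'"
        using multiplicity_decompose'[of m p] p less.prems unfolding k_def
        by (metis bot_nat_0.not_eq_extremum not_prime_unit)
      have "m' > 0" using m' less.prems by (intro Nat.gr0I) auto
      have "k > 0" using p less.prems unfolding k_def by (simp add: prime_multiplicity_gt_zero_iff)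
      then have "1 < p ^ k" using p(1) prime_gt_1_nat one_less_power by blast
      then have "m' < m" using m'(1) \<open>m' > 0\<close> by simp
      then have IH: "(\<Sum>d | d dvd m'. c d) \<ge> 0" "(\<Sum>d | d dvd m' ^ 2. c d) \<ge> 1"
        using less.IH[of m'] \<open>m' > 0\<close> by auto
      have "(\<Sum>d | d dvd m. c d) = (\<Sum>i\<le>k. c p ^ i) * (\<Sum>d | d dvd m'. c d)"
        unfolding m'(1) using m' p(1) \<open>m' > 0\<close> by (intro sum_divisors_prime_power_mult mult one)
      moreover have "m ^ 2 = p ^ (2 * k) * m' ^ 2"
        using m'(1) by (simp add: power_mult_distrib mult.commute flip: power_mult)
      then have "(\<Sum>d | d dvd m ^ 2. c d) = (\<Sum>i\<le>2 * k. c p ^ i) * (\<Sum>d | d dvd m' ^ 2. c d)"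
        using sum_divisors_prime_power_mult[OF mult one p(1), of "m' ^ 2" "2 * k"] m'(2) p(1) \<open>m' > 0\<close>
        by (simp add: prime_dvd_power_iff)
      moreover have "(\<Sum>i\<le>k. c p ^ i) \<ge> 0" "(\<Sum>i\<le>2 * k. c p ^ i) \<ge> 1"
        using power_sum_sign[OF vals[of p], of k] power_sum_sign[OF vals[of p], of "2 * k"] by (auto split: if_splits)
      ultimately show ?thesis
        using IH mult_mono[of 1 "\<Sum>i\<le>2 * k. c p ^ i" 1 "\<Sum>d | d dvd m' ^ 2. c d"] by simp
    qed
  qed
  then show "m > 0 \<Longrightarrow> (\<Sum>d | d dvd m. c d) \<ge> 0" "m > 0 \<Longrightarrow> (\<Sum>d | d dvd m ^ 2. c d) \<ge> 1"
    by auto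
qed

text \<open>AM-GM applied to the terms \<open>i\<close> and \<open>k - i\<close>. The base is a
  square so that half-integral powers of it are available.\<close>

lemma geometric_sum_ge:
  fixes u :: real
  assumes "u > 0"
  shows "(\<Sum>i<Suc k. (u ^ 2) ^ i) \<ge> Suc k * u ^ k"
proof -
  have "2 * (\<Sum>i<Suc k. (u ^ 2) ^ i) = (\<Sum>i<Suc k. (u ^ 2) ^ i) + (\<Sum>i<Suc k. (u ^ 2) ^ (k - i))"
    using sum.nat_diff_reindex[of "\<lambda>i. (u ^ 2) ^ i" "Suc k"] by simp
  also have "\<dots> = (\<Sum>i<Suc k. (u ^ i) ^ 2 + (u ^ (k - i)) ^ 2)"
    by (simp add: sum.distrib flip: power_mult) (simp add: mult.commute)
  also have "\<dots> \<ge> (\<Sum>i<Suc k. 2 * u ^ k)"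
  proof (intro sum_mono)
    fix i assume "i \<in> {..<Suc k}"
    then have "u ^ k = u ^ i * u ^ (k - i)" by (simp flip: power_add)
    then show "2 * u ^ k \<le> (u ^ i) ^ 2 + (u ^ (k - i)) ^ 2"
      using sum_squares_bound[of "u ^ i" "u ^ (k - i)"] by simp
  qed
  finally show ?thesis by simp
qed

text \<open>The coefficient of \<open>c k\<close> in the difference of \<open>\<Sum>c k / (k (1 - t))\<close> and the Lambert series
  \<open>\<Sum>c k t\<^sup>k / (1 - t\<^sup>k)\<close>.\<close>

definition monsky_weight :: "real \<Rightarrow> nat \<Rightarrow> real" where
  "monsky_weight t k = 1 / (k * (1 - t)) - t ^ k / (1 - t ^ k)"

text \<open>Times \<open>1 - t\<close>, the weight is \<open>1 / k - t ^ k / s k\<close> with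
  \<open>s k = 1 + t + ... + t ^ (k - 1)\<close>. It decreases because
  \<open>k * (k + 1) * t ^ k \<le> s k * s (k + 1)\<close>, which AM-GM on both sums gives with half
  a power of \<open>t\<close> to spare.\<close>

lemma
  assumes t: "0 < t" "t < 1" and k: "k \<ge> 1"
  shows monsky_weight_nonneg: "monsky_weight t k \<ge> 0"
    and monsky_weight_decreasing: "monsky_weight t (Suc k) \<le> monsky_weight t k"
proof -
  define s where "s k = (\<Sum>i<k. t ^ i)" for k
  have geo: "1 - t ^ k = (1 - t) * s k" for k
    unfolding s_def by (rule one_diff_power_eq)
  have s_pos: "s k > 0" if "k \<ge> 1" for k
    unfolding s_def using t that by (intro sum_pos) (auto simp: lessThan_empty_iff)
  have weight: "(1 - t) * monsky_weight t k = 1 / k - t ^ k / s k" if "k \<ge> 1" for k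
  proof -
    have "x * (1 / (a * x) - y / (x * z)) = 1 / a - y / z" if "x \<noteq> 0" for x y z a :: real
      using that by (simp add: right_diff_distrib)
    then show ?thesis using t unfolding monsky_weight_def geo by simp
  qed
  have "k * t ^ k = (\<Sum>i<k. t ^ k)" by simp
  also have "\<dots> \<le> s k" unfolding s_def using t by (intro sum_mono power_decreasing) auto
  finally have "t ^ k / s k \<le> 1 / k" using k s_pos[OF k] by (simp add: field_simps)
  then have "0 \<le> (1 - t) * monsky_weight t k" using weight[OF k] by simp
  then show "monsky_weight t k \<ge> 0" using t by (simp add: zero_le_mult_iff)
  define u where "u = sqrt t"
  have u: "0 < u" "u < 1" "u ^ 2 = t" using t by (auto simp: u_def)
  obtain j where j: "k = Suc j" using k by (cases k) auto
  have "real k * real (Suc k) * t ^ k \<le> real k * real (Suc k) * (u ^ j * u ^ k)"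
  proof (intro mult_left_mono)
    have "t ^ k = u ^ (k + k)" using u(3) by (metis mult_2 power_mult)
    also have "\<dots> \<le> u ^ (j + k)" using u j by (intro power_decreasing) auto
    finally show "t ^ k \<le> u ^ j * u ^ k" by (simp add: power_add)
  qed simp
  also have "\<dots> = (k * u ^ j) * (Suc k * u ^ k)" by (simp add: algebra_simps)
  also have "\<dots> \<le> s k * s (Suc k)"
    using geometric_sum_ge[OF u(1), of j] geometric_sum_ge[OF u(1), of k] u s_pos[OF k] j
    unfolding s_def u(3) by (intro mult_mono) (auto simp del: sum.lessThan_Suc)
  finally have amgm: "real k * real (Suc k) * t ^ k \<le> s k * s (Suc k)" .
  have s_Suc: "s (Suc k) = 1 + t * s k"
    unfolding s_def by (subst sum.lessThan_Suc_shift) (simp add: sum_distrib_left)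
  have "t ^ k / s k - t ^ Suc k / s (Suc k) = t ^ k / (s k * s (Suc k))"
    using s_pos[OF k] s_pos[of "Suc k"] by (simp add: field_simps) (simp add: s_Suc algebra_simps)
  also have "\<dots> \<le> 1 / (real k * real (Suc k))"
    using amgm s_pos[OF k] s_pos[of "Suc k"] k by (simp add: divide_simps mult.commute)
  also have "\<dots> = 1 / k - 1 / Suc k" using k by (simp add: field_simps)
  finally have "(1 - t) * monsky_weight t (Suc k) \<le> (1 - t) * monsky_weight t k"
    using weight[OF k] weight[of "Suc k"] by simp
  then show "monsky_weight t (Suc k) \<le> monsky_weight t k" using t by simp
qed

text \<open>Monsky's argument: if the sum of \<open>c k / k\<close> vanished, then Abel summation would bound the Lambert series
  \<open>\<Sum>c k t\<^sup>k / (1 - t\<^sup>k)\<close> as \<open>t\<close> tends to 1. Its power series has nonnegative coefficients that are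
  at least 1 at the squares, so it diverges.\<close>

lemma real_character_L1_nonzero:
  fixes c :: "nat \<Rightarrow> real"
  assumes mult: "\<And>a b. c (a * b) = c a * c b" and one: "c 1 = 1"
    and vals: "\<And>a. c a \<in> {-1, 0, 1}" and bound: "\<And>N. \<bar>\<Sum>k<N. c k\<bar> \<le> B"
  shows "\<not> (\<lambda>N. \<Sum>k=1..N. c k / k) \<longlonglongrightarrow> 0"
proof
  assume lim: "(\<lambda>N. \<Sum>k=1..N. c k / k) \<longlonglongrightarrow> 0"
  have squares: "(\<Sum>k=1..K. t ^ (k ^ 2)) \<le> 2 * B" if t: "0 < t" "t < 1" for t :: real and K :: nat
  proof -
    define F where "F N = (\<Sum>m=1..N. (\<Sum>d | d dvd m. c d) * t ^ m)" for N
    define T where "T N = (\<Sum>k=1..N. c k / k)" for N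
    have lower: "(\<Sum>k=1..K. t ^ (k ^ 2)) \<le> F N" if "N \<ge> K ^ 2" for N
    proof -
      have "(\<Sum>k=1..K. t ^ (k ^ 2)) \<le> (\<Sum>k=1..K. (\<Sum>d | d dvd k ^ 2. c d) * t ^ (k ^ 2))"
        using t sum_divisors_real_character_square[OF mult one vals]
        by (intro sum_mono) (auto simp: mult_le_cancel_right1)
      also have "\<dots> = (\<Sum>m\<in>(\<lambda>k. k ^ 2) ` {1..K}. (\<Sum>d | d dvd m. c d) * t ^ m)"
        by (subst sum.reindex) (auto simp: inj_on_def power2_eq_iff_nonneg)
      also have "\<dots> \<le> F N"
        unfolding F_def
      proof (intro sum_mono2)
        show "(\<lambda>k. k ^ 2) ` {1..K} \<subseteq> {1..N}"
          using order.trans[OF power_mono that] by auto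
        show "0 \<le> (\<Sum>d | d dvd m. c d) * t ^ m" if "m \<in> {1..N} - (\<lambda>k. k ^ 2) ` {1..K}" for m
          using that t sum_divisors_real_character_nonneg[OF mult one vals, of m] by auto
      qed auto
      finally show ?thesis .
    qed
    \<comment> \<open>Truncation of the Lambert series at \<open>N\<close> leaves at most
      \<open>t ^ (N + 1) / (1 - t)\<close> for each \<open>d \<le> N\<close>. Both this and the term
      with \<open>T N\<close> vanish as \<open>N\<close> grows for fixed \<open>t\<close>, so only
      the Abel bound \<open>2 * B\<close> remains, uniformly in \<open>t\<close>.\<close>
    have upper: "F N \<le> \<bar>T N\<bar> / (1 - t) + 2 * B + t / (1 - t) * (real N * t ^ N)" for N
    proof -
      have "F N = (\<Sum>m=1..N. \<Sum>d | d dvd m. c d * t ^ (d * (m div d)))"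
        unfolding F_def by (simp add: sum_distrib_right)
      also have "\<dots> = (\<Sum>d=1..N. \<Sum>j=1..N div d. c d * t ^ (d * j))"
        by (rule sum_divisors_interchange)
      also have "\<dots> = (\<Sum>d=1..N. c d * (t ^ d / (1 - t ^ d)) - c d * (t ^ (d * (N div d + 1)) / (1 - t ^ d)))"
      proof (intro sum.cong refl)
        fix d assume d: "d \<in> {1..N}"
        have lt: "t ^ d < 1" using t d by (simp add: power_less_one_iff)
        have "(\<Sum>j=1..M. q ^ j) = (q - q ^ (M + 1)) / (1 - q)" if "q < 1" for q :: real and M
        proof (induction M)
          case (Suc M)
          have "(q - q ^ (M + 1)) / (1 - q) + q ^ (M + 1) = (q - q * q ^ (M + 1)) / (1 - q)"
            using that by (simp add: field_simps)
          then show ?case using Suc by simp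
        qed simp
        from this[OF lt, of "N div d"]
        show "(\<Sum>j=1..N div d. c d * t ^ (d * j)) =
            c d * (t ^ d / (1 - t ^ d)) - c d * (t ^ (d * (N div d + 1)) / (1 - t ^ d))"
          by (simp only: power_mult sum_distrib_left[symmetric] diff_divide_distrib right_diff_distrib)
      qed
      also have "\<dots> = (\<Sum>d=1..N. c d * (t ^ d / (1 - t ^ d))) -
          (\<Sum>d=1..N. c d * (t ^ (d * (N div d + 1)) / (1 - t ^ d)))"
        by (rule sum_subtractf)
      also have "\<dots> \<le> \<bar>\<Sum>d=1..N. c d * (t ^ d / (1 - t ^ d))\<bar> +
          \<bar>\<Sum>d=1..N. c d * (t ^ (d * (N div d + 1)) / (1 - t ^ d))\<bar>"
        by linarith
      also have "\<bar>\<Sum>d=1..N. c d * (t ^ (d * (N div d + 1)) / (1 - t ^ d))\<bar> \<le> (\<Sum>d=1..N. t ^ (N + 1) / (1 - t))"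
      proof (intro order.trans[OF sum_abs] sum_mono)
        fix d assume d: "d \<in> {1..N}"
        have lt: "t ^ d < 1" "t ^ d \<le> t" using t d power_decreasing[of 1 d t]
          by (auto simp: power_less_one_iff)
        have "N < d * (N div d + 1)" using d dividend_less_times_div[of d N] by simp
        then have "t ^ (d * (N div d + 1)) / (1 - t ^ d) \<le> t ^ (N + 1) / (1 - t)"
          using t lt by (intro frac_le power_decreasing) auto
        moreover have "\<bar>c d\<bar> \<le> 1" using vals[of d] by auto
        ultimately show "\<bar>c d * (t ^ (d * (N div d + 1)) / (1 - t ^ d))\<bar> \<le> t ^ (N + 1) / (1 - t)"
          using t lt mult_mono[of "\<bar>c d\<bar>" 1 "t ^ (d * (N div d + 1)) / (1 - t ^ d)" "t ^ (N + 1) / (1 - t)"]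
          by (simp add: abs_mult)
      qed
      also have "\<bar>\<Sum>d=1..N. c d * (t ^ d / (1 - t ^ d))\<bar> =
          \<bar>T N / (1 - t) - (\<Sum>d\<in>{1..<Suc N}. c d * monsky_weight t d)\<bar>"
        unfolding T_def monsky_weight_def
        by (simp add: sum_divide_distrib sum_subtractf right_diff_distrib atLeastLessThanSuc_atLeastAtMost)
      also have "\<dots> \<le> \<bar>T N\<bar> / (1 - t) + 2 * B * monsky_weight t 1"
      proof -
        have "\<bar>\<Sum>d\<in>{1..<Suc N}. c d * monsky_weight t d\<bar> \<le> 2 * B * monsky_weight t 1"
          using abel_summation_bound[of c B 1 "monsky_weight t" "Suc N"] bound
            monsky_weight_nonneg[OF t] monsky_weight_decreasing[OF t] by simp
        moreover have "\<bar>T N / (1 - t)\<bar> = \<bar>T N\<bar> / (1 - t)" using t by simp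
        ultimately show ?thesis by linarith
      qed
      also have "monsky_weight t 1 = 1" using t by (simp add: monsky_weight_def field_simps)
      finally show ?thesis by (simp add: mult.left_commute)
    qed
    have "(\<lambda>N. \<bar>T N\<bar> / (1 - t) + 2 * B + t / (1 - t) * (real N * t ^ N)) \<longlonglongrightarrow>
        \<bar>0\<bar> / (1 - t) + 2 * B + t / (1 - t) * 0"
      using t lim unfolding T_def by (intro tendsto_intros powser_times_n_limit_0) auto
    then show ?thesis
      using lower upper by (intro LIMSEQ_le_const[of _ "2 * B"]) (auto intro: order.trans)
  qed
  obtain K :: nat where K: "real K > 2 * B" using reals_Archimedean2 by blast
  have "((\<lambda>t::real. \<Sum>k=1..K. t ^ (k ^ 2)) \<longlongrightarrow> (\<Sum>k=1..K. 1 ^ (k ^ 2))) (at_left 1)"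
    by (intro tendsto_intros)
  moreover have "eventually (\<lambda>t::real. (\<Sum>k=1..K. t ^ (k ^ 2)) \<le> 2 * B) (at_left 1)"
    using eventually_at_left[of 0 "1::real"] squares by (auto intro!: exI[of _ 0])
  ultimately have "(\<Sum>k=1..K. 1 ^ (k ^ 2)) \<le> 2 * B"
    by (rule tendsto_upperbound) simp
  then show False using K by simp
qed

section \<open>Dirichlet's theorem\<close>

definition L1_partial :: "(nat \<Rightarrow> complex) \<Rightarrow> nat \<Rightarrow> complex" where
  "L1_partial \<chi> x = (\<Sum>k=1..x. \<chi> k / of_nat k)"

definition mangoldt_twisted :: "(nat \<Rightarrow> complex) \<Rightarrow> nat \<Rightarrow> complex" where
  "mangoldt_twisted \<chi> x = (\<Sum>k=1..x. \<chi> k * mangoldt k / of_nat k)"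

lemma ex_ln_nat_gt: "\<exists>x::nat>0. K < ln (real x)"
proof -
  obtain x :: nat where x: "exp K < x" using reals_Archimedean2 by blast
  then have "0 < real x" using exp_gt_zero[of K] by linarith
  moreover from this x have "ln (exp K) < ln (real x)" by (subst ln_less_cancel_iff) auto
  ultimately show ?thesis by auto
qed

text \<open>Makes the tail bound for \<open>L1_partial\<close> at \<open>x div d\<close> linear in
  \<open>d\<close>, which cancels the factor \<open>1 / d\<close> in convolution sums.\<close>

lemma inverse_Suc_div_le:
  assumes "d \<in> {1..x}"
  shows "1 / real (x div d + 1) \<le> d / x"
proof -
  have "x \<le> d * (x div d + 1)"
    using assms dividend_less_times_div[of d x] by simp
  then have "real x \<le> real d * real (x div d + 1)" by (metis of_nat_le_iff of_nat_mult)
  then show ?thesis using assms by (simp add: field_simps)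
qed

section \<open>A nonprincipal character: the L-value at 1 and Mangoldt sums\<close>

context
  fixes n :: nat and \<chi> :: "nat \<Rightarrow> complex"
  assumes n: "n > 0" and \<chi>: "\<chi> \<in> dchars n" "\<chi> \<noteq> dchar0 n"
begin


lemma L1_partial_diff:
  assumes "y \<le> z"
  shows "norm (L1_partial \<chi> z - L1_partial \<chi> y) \<le> 2 * n / (y + 1)"
proof -
  have "L1_partial \<chi> z = L1_partial \<chi> y + (\<Sum>k\<in>{Suc y..<Suc z}. \<chi> k / of_nat k)"
    using assms unfolding L1_partial_def
    by (subst sum.union_disjoint[symmetric]) (auto intro!: sum.cong)
  then have "L1_partial \<chi> z - L1_partial \<chi> y = (\<Sum>k\<in>{Suc y..<Suc z}. \<chi> k * of_real (1 / k))"
    by simp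
  also have "norm \<dots> \<le> 2 * real n * (1 / Suc y)"
    by (rule abel_summation_bound)
      (use dchars_partial_sum_bound[OF \<chi> n] in \<open>auto simp: field_simps\<close>)
  finally show ?thesis by (simp add: add.commute)
qed

lemma L1_lim: "L1_partial \<chi> \<longlonglongrightarrow> lim (L1_partial \<chi>)"
proof -
  have "Cauchy (L1_partial \<chi>)"
  proof (rule CauchyI)
    fix e :: real assume e: "e > 0"
    obtain M :: nat where M: "2 * n / e < M" using reals_Archimedean2 by blast
    have "norm (L1_partial \<chi> m - L1_partial \<chi> k) < e" if "m \<ge> M" "m \<le> k" for m k
    proof -
      have "2 * n / e < real m + 1" using M that(1) by linarith
      then have "2 * n / (real m + 1) < e" using e by (simp add: field_simps)
      then show ?thesis using L1_partial_diff[of m k] that(2) by (simp add: norm_minus_commute add.commute)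
    qed
    then show "\<exists>M. \<forall>m\<ge>M. \<forall>k\<ge>M. norm (L1_partial \<chi> m - L1_partial \<chi> k) < e"
      by (metis nat_le_linear norm_minus_commute)
  qed
  then show ?thesis
    by (simp add: Cauchy_convergent_iff convergent_LIMSEQ_iff)
qed

lemma L1_tail: "norm (L1_partial \<chi> y - lim (L1_partial \<chi>)) \<le> 2 * n / (y + 1)"
proof -
  have "(\<lambda>z. norm (L1_partial \<chi> y - L1_partial \<chi> z)) \<longlonglongrightarrow> norm (L1_partial \<chi> y - lim (L1_partial \<chi>))"
    by (intro tendsto_intros L1_lim)
  then show ?thesis
    by (rule LIMSEQ_le_const2) (use L1_partial_diff[of y] in \<open>auto simp: norm_minus_commute\<close>)
qed

lemma dirichlet_convolution_sum:
  fixes h :: "nat \<Rightarrow> complex"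
  shows "(\<Sum>k=1..x. \<chi> k / of_nat k * (\<Sum>d | d dvd k. h d)) =
    (\<Sum>d=1..x. \<chi> d * h d / of_nat d * L1_partial \<chi> (x div d))"
proof -
  have "(\<Sum>k=1..x. \<chi> k / of_nat k * (\<Sum>d | d dvd k. h d)) =
      (\<Sum>k=1..x. \<Sum>d | d dvd k. \<chi> d * h d / of_nat d * (\<chi> (k div d) / of_nat (k div d)))"
    unfolding sum_distrib_left
  proof (intro sum.cong refl)
    fix k d :: nat assume "d \<in> {d. d dvd k}"
    then obtain e where e: "k = d * e" by auto
    then show "\<chi> k / of_nat k * h d = \<chi> d * h d / of_nat d * (\<chi> (k div d) / of_nat (k div d))"
      by (cases "d = 0") (auto simp: dchars_mult[OF \<chi>(1)])
  qed
  also have "\<dots> = (\<Sum>d=1..x. \<Sum>m=1..x div d. \<chi> d * h d / of_nat d * (\<chi> m / of_nat m))"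
    by (rule sum_divisors_interchange)
  finally show ?thesis by (simp add: L1_partial_def sum_distrib_left)
qed

lemma twisted_ln_sum_bound: "norm (\<Sum>k=1..x. \<chi> k / of_nat k * of_real (ln (real k))) \<le> 8 * real n"
proof -
  \<comment> \<open>Unlike \<open>ln k / k\<close>, the weight \<open>(ln k + 2) / k\<close> decreases from \<open>k = 1\<close> on.\<close>
  have "(\<Sum>k=1..x. \<chi> k / of_nat k * of_real (ln (real k))) =
      (\<Sum>k\<in>{1..<Suc x}. \<chi> k * of_real ((ln k + 2) / k)) - 2 * (\<Sum>k\<in>{1..<Suc x}. \<chi> k * of_real (1 / k))"
    by (simp add: sum_distrib_left add_divide_distrib algebra_simps sum.distrib atLeastLessThanSuc_atLeastAtMost)
  also have "norm \<dots> \<le> 2 * real n * ((ln (real 1) + 2) / real 1) + 2 * (2 * real n * (1 / real 1))"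
  proof (intro order.trans[OF norm_triangle_ineq4] add_mono)
    show "norm (\<Sum>k\<in>{1..<Suc x}. \<chi> k * of_real ((ln k + 2) / k)) \<le> 2 * real n * ((ln (real 1) + 2) / real 1)"
    proof (rule abel_summation_bound)
      fix k :: nat assume k: "1 \<le> k"
      have "real (Suc k) = real k * (1 + 1 / k)" using k by (simp add: field_simps)
      then have "ln (real (Suc k)) = ln k + ln (1 + 1 / real k)"
        using k by (simp only:) (subst ln_mult_pos, auto simp: field_simps)
      also have "ln (1 + 1 / real k) \<le> 1 / k" by (rule ln_add_one_self_le_self) simp
      finally have "k * ln (real (Suc k)) \<le> k * (ln k + 1 / k)" by (intro mult_left_mono) auto
      then have *: "k * ln (real (Suc k)) \<le> k * ln k + 1" using k by (simp add: distrib_left)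
      have "ln k \<ge> 0" using k by simp
      then have "k * (ln (real (Suc k)) + 2) \<le> (ln k + 2) * Suc k"
        using * by (simp add: algebra_simps)
      then show "(ln (real (Suc k)) + 2) / real (Suc k) \<le> (ln k + 2) / real k"
        using k by (simp add: divide_simps mult.commute)
      show "0 \<le> (ln k + 2) / real k" using \<open>ln k \<ge> 0\<close> by simp
    qed (use dchars_partial_sum_bound[OF \<chi> n] in auto)
    have "norm (\<Sum>k\<in>{1..<Suc x}. \<chi> k * of_real (1 / k)) \<le> 2 * real n * (1 / real 1)"
      by (rule abel_summation_bound)
        (use dchars_partial_sum_bound[OF \<chi> n] in \<open>auto simp: field_simps\<close>)
    then show "norm (2 * (\<Sum>k\<in>{1..<Suc x}. \<chi> k * of_real (1 / k))) \<le> 2 * (2 * real n * (1 / real 1))"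
      by (simp add: norm_mult)
  qed
  finally show ?thesis by simp
qed

text \<open>Expand \<open>ln\<close> through \<open>mangoldt\<close> in the sum of
  \<open>\<chi> k * ln k / k\<close>, which is at most \<open>8 * n\<close>. Replacing each
  \<open>L1_partial \<chi> (x div d)\<close> by its limit costs \<open>2 * n / x\<close> times the
  Chebyshev sum, again at most \<open>8 * n\<close>.\<close>

lemma mangoldt_twisted_bounded:
  assumes "lim (L1_partial \<chi>) \<noteq> 0"
  shows "norm (mangoldt_twisted \<chi> x) \<le> 16 * n / norm (lim (L1_partial \<chi>))"
proof (cases "x = 0")
  case True
  then show ?thesis by (simp add: mangoldt_twisted_def)
next
  case False
  let ?L = "lim (L1_partial \<chi>)"
  let ?h = "\<lambda>d. \<chi> d * mangoldt d / of_nat d"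
  have "(\<Sum>k=1..x. \<chi> k / of_nat k * of_real (ln (real k))) =
      (\<Sum>k=1..x. \<chi> k / of_nat k * (\<Sum>d | d dvd k. mangoldt d))"
    by (intro sum.cong refl) (simp add: mangoldt_sum)
  also have "\<dots> = (\<Sum>d=1..x. ?h d * L1_partial \<chi> (x div d))"
    by (rule dirichlet_convolution_sum)
  also have "\<dots> = (\<Sum>d=1..x. ?h d * (L1_partial \<chi> (x div d) - ?L)) + mangoldt_twisted \<chi> x * ?L"
    by (simp add: mangoldt_twisted_def sum_distrib_right right_diff_distrib sum_subtractf)
  finally have "mangoldt_twisted \<chi> x * ?L = (\<Sum>k=1..x. \<chi> k / of_nat k * of_real (ln (real k))) -
      (\<Sum>d=1..x. ?h d * (L1_partial \<chi> (x div d) - ?L))" by simp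
  also have "norm \<dots> \<le> 8 * real n + 8 * real n"
  proof (intro order.trans[OF norm_triangle_ineq4] add_mono twisted_ln_sum_bound)
    have "norm (\<Sum>d=1..x. ?h d * (L1_partial \<chi> (x div d) - ?L)) \<le> (\<Sum>d=1..x. 2 * n / x * mangoldt d)"
    proof (rule sum_norm_le)
      fix d assume d: "d \<in> {1..x}"
      have "norm (L1_partial \<chi> (x div d) - ?L) \<le> 2 * n * (1 / real (x div d + 1))"
        using L1_tail[of "x div d"] by (simp add: add.commute)
      also have "\<dots> \<le> 2 * n * (d / x)" using inverse_Suc_div_le[OF d] by (intro mult_left_mono) auto
      finally have T: "norm (L1_partial \<chi> (x div d) - ?L) \<le> 2 * n * (d / x)" .
      have "norm (?h d) \<le> 1 * mangoldt d / d"
        using dchars_norm_le[OF \<chi>(1) n, of d] unfolding norm_mult norm_divide norm_of_nat norm_mangoldt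
        by (intro mult_right_mono divide_right_mono) (auto simp: mangoldt_nonneg)
      then have "norm (?h d * (L1_partial \<chi> (x div d) - ?L)) \<le> (1 * mangoldt d / d) * (2 * n * (d / x))"
        unfolding norm_mult[of "?h d"] using T by (intro mult_mono) (auto simp: mangoldt_nonneg)
      then show "norm (?h d * (L1_partial \<chi> (x div d) - ?L)) \<le> 2 * n / x * mangoldt d"
        using d by (simp add: mult_ac)
    qed
    also have "\<dots> = 2 * n / x * (\<Sum>d=1..x. mangoldt d)" by (simp add: sum_distrib_left)
    also have "\<dots> \<le> 2 * n / x * (4 * x)" by (intro mult_left_mono chebyshev_psi_le) auto
    finally show "norm (\<Sum>d=1..x. ?h d * (L1_partial \<chi> (x div d) - ?L)) \<le> 8 * real n" using False by simp
  qed
  finally show ?thesis using assms by (simp add: norm_mult field_simps)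
qed

text \<open>Twist \<open>mu_ln_sum_divisors\<close> by \<open>\<chi>\<close>. With limit 0 every
  \<open>L1_partial \<chi> (x div d)\<close> is as small as its tail, and the sum of
  \<open>ln (x / d)\<close> is at most \<open>x\<close> by \<open>ln_fact_ge\<close>.\<close>

lemma mangoldt_twisted_if_L1_zero:
  assumes L: "lim (L1_partial \<chi>) = 0" and x: "x > 0"
  shows "norm (mangoldt_twisted \<chi> x + of_real (ln x)) \<le> 2 * n"
proof -
  let ?h = "\<lambda>d. complex_of_real (mu d * ln (x / d))"
  have "(\<Sum>k=1..x. \<chi> k / of_nat k * (\<Sum>d | d dvd k. ?h d)) =
      (\<Sum>k=1..x. (if k = 1 then of_real (ln x) else 0) + \<chi> k * mangoldt k / of_nat k)"
  proof (intro sum.cong refl)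
    fix k assume "k \<in> {1..x}"
    then have "(\<Sum>d | d dvd k. ?h d) = of_real ((if k = 1 then ln x else 0) + mangoldt k)"
      using mu_ln_sum_divisors[of k "real x"] x by (simp only: of_real_sum[symmetric]) simp
    then show "\<chi> k / of_nat k * (\<Sum>d | d dvd k. ?h d) =
        (if k = 1 then of_real (ln x) else 0) + \<chi> k * mangoldt k / of_nat k"
      using dchars_one[OF \<chi>(1)] by (simp add: algebra_simps)
  qed
  also have "\<dots> = mangoldt_twisted \<chi> x + of_real (ln x)"
    using x by (simp add: sum.distrib mangoldt_twisted_def)
  finally have "mangoldt_twisted \<chi> x + of_real (ln x) =
      (\<Sum>d=1..x. \<chi> d * ?h d / of_nat d * L1_partial \<chi> (x div d))"
    using dirichlet_convolution_sum[of ?h x] by simp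
  also have "norm \<dots> \<le> (\<Sum>d=1..x. 2 * n / x * ln (x / d))"
  proof (rule sum_norm_le)
    fix d assume d: "d \<in> {1..x}"
    have "norm (L1_partial \<chi> (x div d)) \<le> 2 * n * (1 / real (x div d + 1))"
      using L1_tail[of "x div d"] L by (simp add: add.commute)
    also have "\<dots> \<le> 2 * n * (d / x)" using inverse_Suc_div_le[OF d] by (intro mult_left_mono) auto
    finally have T: "norm (L1_partial \<chi> (x div d)) \<le> 2 * n * (d / x)" .
    have "ln (x / d) \<ge> 0" using d by simp
    then have "norm (?h d) \<le> 1 * ln (x / d)"
      unfolding norm_of_real abs_mult using abs_mu_le[of d] by (intro mult_mono) auto
    then have "norm (\<chi> d * ?h d / of_nat d * L1_partial \<chi> (x div d)) \<le> (1 * ln (x / d) / d) * (2 * n * (d / x))"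
      using dchars_norm_le[OF \<chi>(1) n, of d] T \<open>ln (x / d) \<ge> 0\<close>
      unfolding norm_mult norm_divide norm_of_nat
      by (intro mult_mono divide_right_mono) (auto simp flip: norm_mult)
    then show "norm (\<chi> d * ?h d / of_nat d * L1_partial \<chi> (x div d)) \<le> 2 * n / x * ln (x / d)"
      using d by (simp add: mult_ac)
  qed
  also have "\<dots> = 2 * n / x * (\<Sum>d=1..x. ln (x / d))" by (simp only: sum_distrib_left)
  also have "(\<Sum>d=1..x. ln (x / d)) = x * ln x - ln (fact x)"
    using x by (simp add: ln_div sum_subtractf ln_fact_eq_sum)
  also have "2 * n / x * (x * ln x - ln (fact x)) \<le> 2 * n / x * x"
    using ln_fact_ge[of x] by (intro mult_left_mono) auto
  finally show ?thesis using x by simp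
qed

end

section \<open>Nonvanishing of L-values and primes in residue classes\<close>

lemma dchars_sum_all:
  assumes "n > 0"
  shows "(\<Sum>\<chi>\<in>dchars n. \<chi> c) = (if [c = 1] (mod n) then of_nat (card (dchars n)) else 0)"
proof (cases "coprime c n")
  case False
  then have "\<not> [c = 1] (mod n)" by (metis cong_imp_coprime cong_sym coprime_1_left)
  moreover have "(\<Sum>\<chi>\<in>dchars n. \<chi> c) = 0"
    using False dchars_eq_0_iff by (intro sum.neutral) blast
  ultimately show ?thesis by simp
qed (rule dchars_orthogonality[OF assms])

text \<open>As \<open>a'\<close> inverts \<open>a\<close>, the value \<open>\<chi> a'\<close> is the
  conjugate of \<open>\<chi> a\<close>, and orthogonality picks out the class of
  \<open>a\<close>.\<close>

lemma mangoldt_twisted_sum: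
  assumes n: "n > 0" and a': "[a * a' = 1] (mod n)"
  shows "(\<Sum>\<chi>\<in>dchars n. \<chi> a' * mangoldt_twisted \<chi> x) =
    of_real (card (dchars n) * (\<Sum>k | k \<in> {1..x} \<and> [k = a] (mod n). mangoldt k / real k))"
proof -
  have iff: "[a' * k = 1] (mod n) \<longleftrightarrow> [k = a] (mod n)" for k
  proof
    assume "[a' * k = 1] (mod n)"
    then have "[a * (a' * k) = a * 1] (mod n)" by (rule cong_scalar_left)
    moreover have "[a * (a' * k) = 1 * k] (mod n)"
      using cong_scalar_right[OF a', of k] by (simp add: mult.assoc)
    ultimately show "[k = a] (mod n)" by (metis cong_sym cong_trans mult_1 mult.right_neutral)
  next
    assume "[k = a] (mod n)"
    then have "[a' * k = a' * a] (mod n)" by (rule cong_scalar_left)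
    then show "[a' * k = 1] (mod n)" using a' by (metis cong_trans mult.commute)
  qed
  have "(\<Sum>\<chi>\<in>dchars n. \<chi> a' * mangoldt_twisted \<chi> x) =
      (\<Sum>\<chi>\<in>dchars n. \<Sum>k=1..x. \<chi> (a' * k) * (mangoldt k / of_nat k))"
    unfolding mangoldt_twisted_def sum_distrib_left
    by (intro sum.cong refl) (simp add: dchars_mult mult.assoc)
  also have "\<dots> = (\<Sum>k=1..x. (\<Sum>\<chi>\<in>dchars n. \<chi> (a' * k)) * (mangoldt k / of_nat k))"
    by (subst sum.swap) (simp add: sum_distrib_right del: times_divide_eq_right)
  also have "\<dots> = (\<Sum>k=1..x. if [k = a] (mod n) then of_nat (card (dchars n)) * (mangoldt k / of_nat k) else 0)"
    unfolding dchars_sum_all[OF n] iff by (intro sum.cong) auto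
  also have "\<dots> = (\<Sum>k | k \<in> {1..x} \<and> [k = a] (mod n). of_nat (card (dchars n)) * (mangoldt k / of_nat k))"
    by (intro sum.mono_neutral_cong_right) auto
  finally show ?thesis by (simp add: sum_distrib_left)
qed

lemma mangoldt_twisted_dchar0:
  "mangoldt_twisted (dchar0 n) x = of_real (\<Sum>k | k \<in> {1..x} \<and> coprime k n. mangoldt k / real k)"
proof -
  have "mangoldt_twisted (dchar0 n) x = (\<Sum>k | k \<in> {1..x} \<and> coprime k n. mangoldt k / of_nat k)"
    unfolding mangoldt_twisted_def dchar0_def by (intro sum.mono_neutral_cong_right) auto
  then show ?thesis by simp
qed

lemma mangoldt_twisted_dchar0_upper:
  assumes "x > 0"
  shows "Re (mangoldt_twisted (dchar0 n) x) \<le> ln x + 4"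
proof -
  have "(\<Sum>k | k \<in> {1..x} \<and> coprime k n. mangoldt k / real k) \<le> (\<Sum>k=1..x. mangoldt k / real k)"
    by (intro sum_mono2) (auto simp: mangoldt_nonneg)
  then show ?thesis using mangoldt_over_sum_upper[OF assms] by (simp add: mangoldt_twisted_dchar0)
qed

text \<open>A \<open>k\<close> that shares a factor with \<open>n\<close> is either a prime dividing
  \<open>n\<close>, hence at most \<open>n\<close>, or not prime at all. Both kinds have bounded
  sums.\<close>

lemma mangoldt_twisted_dchar0_lower:
  assumes "n > 0"
  shows "\<exists>C. \<forall>x>0. Re (mangoldt_twisted (dchar0 n) x) \<ge> ln x - C"
proof -
  obtain C where C: "\<And>x. (\<Sum>k | k \<in> {1..x} \<and> \<not> prime k. mangoldt k / real k) \<le> C"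
    using mangoldt_over_nonprime_bounded by blast
  show ?thesis
  proof (intro exI allI impI)
    fix x :: nat assume x: "x > 0"
    have "(\<Sum>k=1..x. mangoldt k / real k) = (\<Sum>k | k \<in> {1..x} \<and> coprime k n. mangoldt k / real k) +
        (\<Sum>k | k \<in> {1..x} \<and> \<not> coprime k n. mangoldt k / real k)"
      by (subst sum.union_disjoint[symmetric]) (auto intro!: sum.cong)
    also have "(\<Sum>k | k \<in> {1..x} \<and> \<not> coprime k n. mangoldt k / real k) \<le>
        (\<Sum>k\<in>{1..n} \<union> {k. k \<in> {1..x} \<and> \<not> prime k}. mangoldt k / real k)"
    proof (intro sum_mono2 subsetI)
      fix k assume k: "k \<in> {k. k \<in> {1..x} \<and> \<not> coprime k n}"
      then have "prime k \<Longrightarrow> k dvd n" using prime_imp_coprime by blast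
      then show "k \<in> {1..n} \<union> {k. k \<in> {1..x} \<and> \<not> prime k}"
        using k assms dvd_imp_le by auto
    qed (auto simp: mangoldt_nonneg)
    also have "\<dots> \<le> (\<Sum>k=1..n. mangoldt k / real k) + (\<Sum>k | k \<in> {1..x} \<and> \<not> prime k. mangoldt k / real k)"
    proof -
      have "0 \<le> (\<Sum>k\<in>{1..n} \<inter> {k. k \<in> {1..x} \<and> \<not> prime k}. mangoldt k / real k)"
        by (intro sum_nonneg) (simp add: mangoldt_nonneg)
      then show ?thesis
        using sum.union_inter[of "{1..n}" "{k. k \<in> {1..x} \<and> \<not> prime k}" "\<lambda>k. mangoldt k / real k"]
        by simp
    qed
    finally have "ln x - 1 \<le> (\<Sum>k | k \<in> {1..x} \<and> coprime k n. mangoldt k / real k) +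
        ((\<Sum>k=1..n. mangoldt k / real k) + C)"
      using mangoldt_over_sum_lower[OF x] C[of x] by linarith
    then show "ln x - (1 + (\<Sum>k=1..n. mangoldt k / real k) + C) \<le> Re (mangoldt_twisted (dchar0 n) x)"
      by (simp add: mangoldt_twisted_dchar0)
  qed
qed

text \<open>The sum of \<open>mangoldt_twisted \<chi> x\<close> over all characters is nonnegative. The principal character contributes
  \<open>ln x\<close>, and every character with vanishing L-value contributes \<open>- ln x\<close>, up to bounded terms.\<close>

lemma dchars_L1_zero_unique:
  assumes n: "n > 0" and 1: "\<chi> \<in> dchars n" "\<chi> \<noteq> dchar0 n" "lim (L1_partial \<chi>) = 0"
    and 2: "\<psi> \<in> dchars n" "\<psi> \<noteq> dchar0 n" "lim (L1_partial \<psi>) = 0"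
  shows "\<chi> = \<psi>"
proof (rule ccontr)
  assume ne: "\<chi> \<noteq> \<psi>"
  define Z where "Z = {\<phi> \<in> dchars n - {dchar0 n}. lim (L1_partial \<phi>) = 0}"
  have "\<exists>C. \<forall>x>0. Re (mangoldt_twisted \<phi> x) \<le> C - (if \<phi> \<in> Z then ln x else 0)"
    if "\<phi> \<in> dchars n - {dchar0 n}" for \<phi>
  proof (cases "\<phi> \<in> Z")
    case True
    have "Re (mangoldt_twisted \<phi> x) + ln x \<le> 2 * n" if "x > 0" for x
      using mangoldt_twisted_if_L1_zero[OF n, of \<phi> x] True that
        complex_Re_le_cmod[of "mangoldt_twisted \<phi> x + of_real (ln x)"] unfolding Z_def by auto
    then show ?thesis using True by (intro exI[of _ "2 * real n"]) (auto simp: algebra_simps)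
  next
    case False
    have "Re (mangoldt_twisted \<phi> x) \<le> 16 * n / norm (lim (L1_partial \<phi>))" for x
      using mangoldt_twisted_bounded[OF n, of \<phi> x] False that
        complex_Re_le_cmod[of "mangoldt_twisted \<phi> x"] unfolding Z_def by auto
    then show ?thesis using False by auto
  qed
  then obtain C where C: "\<And>\<phi> x. \<phi> \<in> dchars n - {dchar0 n} \<Longrightarrow> x > 0 \<Longrightarrow>
      Re (mangoldt_twisted \<phi> x) \<le> C \<phi> - (if \<phi> \<in> Z then ln x else 0)" by metis
  define K where "K = 4 + (\<Sum>\<phi>\<in>dchars n - {dchar0 n}. C \<phi>)"
  have fin: "finite (dchars n)" using finite_dchars[OF n] .
  have Z2: "card Z \<ge> 2"
    using card_mono[of Z "{\<chi>, \<psi>}"] fin 1 2 ne unfolding Z_def by auto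
  have "ln (real x) \<le> K" if x: "x > 0" for x :: nat
  proof -
    have "0 \<le> Re (\<Sum>\<phi>\<in>dchars n. \<phi> 1 * mangoldt_twisted \<phi> x)"
      using mangoldt_twisted_sum[OF n, of 1 1 x] by (simp add: sum_nonneg mangoldt_nonneg)
    also have "(\<Sum>\<phi>\<in>dchars n. \<phi> 1 * mangoldt_twisted \<phi> x) = (\<Sum>\<phi>\<in>dchars n. mangoldt_twisted \<phi> x)"
      using dchars_one by (intro sum.cong) auto
    also have "\<dots> = mangoldt_twisted (dchar0 n) x + (\<Sum>\<phi>\<in>dchars n - {dchar0 n}. mangoldt_twisted \<phi> x)"
      by (rule sum.remove[OF fin dchar0_in_dchars])
    also have "Re \<dots> \<le> (ln x + 4) + (\<Sum>\<phi>\<in>dchars n - {dchar0 n}. C \<phi> - (if \<phi> \<in> Z then ln x else 0))"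
      using mangoldt_twisted_dchar0_upper[OF x, of n] C x by (auto intro!: add_mono sum_mono)
    also have "(\<Sum>\<phi>\<in>dchars n - {dchar0 n}. if \<phi> \<in> Z then ln (real x) else 0) = (\<Sum>\<phi>\<in>Z. ln (real x))"
      using fin by (intro sum.mono_neutral_cong_right) (auto simp: Z_def)
    then have "(\<Sum>\<phi>\<in>dchars n - {dchar0 n}. C \<phi> - (if \<phi> \<in> Z then ln x else 0)) =
        (\<Sum>\<phi>\<in>dchars n - {dchar0 n}. C \<phi>) - card Z * ln x"
      by (simp add: sum_subtractf)
    finally have "card Z * ln (real x) \<le> ln x + K" unfolding K_def by simp
    moreover have "2 * ln (real x) \<le> card Z * ln (real x)"
      using Z2 x by (intro mult_right_mono) auto
    ultimately show ?thesis by simp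
  qed
  then show False using ex_ln_nat_gt[of K] by (meson not_le)
qed

lemma dchars_L1_nonzero:
  assumes n: "n > 0" and \<chi>: "\<chi> \<in> dchars n" "\<chi> \<noteq> dchar0 n"
  shows "lim (L1_partial \<chi>) \<noteq> 0"
proof
  assume L: "lim (L1_partial \<chi>) = 0"
  have lim: "L1_partial \<chi> \<longlonglongrightarrow> 0" using L1_lim[OF n \<chi>] L by simp
  let ?\<psi> = "\<lambda>a. cnj (\<chi> a)"
  have "(\<lambda>y. cnj (L1_partial \<chi> y)) \<longlonglongrightarrow> cnj 0" by (intro tendsto_cnj lim)
  then have "lim (L1_partial ?\<psi>) = 0"
    by (intro limI) (simp add: L1_partial_def[abs_def] cnj_sum)
  moreover have "?\<psi> \<noteq> dchar0 n"
  proof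
    assume *: "?\<psi> = dchar0 n"
    have "\<chi> a = dchar0 n a" for a
      using arg_cong[OF fun_cong[OF *, of a], of cnj] by (simp add: dchar0_def split: if_splits)
    then show False using \<chi>(2) by blast
  qed
  \<comment> \<open>Zeros come in conjugate pairs, so uniqueness makes \<open>\<chi>\<close> real.\<close>
  ultimately have "?\<psi> = \<chi>"
    using dchars_L1_zero_unique[OF n dchars_cnj[OF \<chi>(1)] _ _ \<chi> L] by blast
  then have real: "\<chi> a = of_real (Re (\<chi> a))" for a
    by (metis Reals_cnj_iff of_real_Re)
  have "\<not> (\<lambda>N. \<Sum>k=1..N. Re (\<chi> k) / k) \<longlonglongrightarrow> 0"
  proof (rule real_character_L1_nonzero)
    fix a b
    show "Re (\<chi> (a * b)) = Re (\<chi> a) * Re (\<chi> b)"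
      using dchars_mult[OF \<chi>(1), of a b] real by (metis of_real_mult Re_complex_of_real)
    show "Re (\<chi> a) \<in> {-1, 0, 1}"
    proof (cases "coprime a n")
      case True
      have "\<bar>Re (\<chi> a)\<bar> = 1" using dchars_norm[OF \<chi>(1) n True] real[of a] by (metis norm_of_real)
      then show ?thesis by auto
    next
      case False
      then show ?thesis using dchars_eq_0_iff[OF \<chi>(1), of a] by simp
    qed
  next
    fix N
    show "\<bar>\<Sum>k<N. Re (\<chi> k)\<bar> \<le> n"
      using abs_Re_le_cmod[of "\<Sum>k<N. \<chi> k"] dchars_partial_sum_bound[OF \<chi> n, of N] by simp
  qed (use dchars_one[OF \<chi>(1)] in simp)
  moreover have "(\<lambda>N. Re (L1_partial \<chi> N)) \<longlonglongrightarrow> Re 0" by (intro tendsto_Re lim)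
  ultimately show False by (simp add: L1_partial_def Re_divide_of_nat)
qed

text \<open>Without a prime in the class its Mangoldt sum would consist of nonprimes and stay
  bounded, whereas the principal character contributes \<open>ln x\<close> and all others a bounded
  amount.\<close>

theorem dirichlet_prime_exists:
  fixes a n :: nat
  assumes n: "n > 0" and a: "coprime a n"
  shows "\<exists>p. prime p \<and> [p = a] (mod n)"
proof (rule ccontr)
  assume no: "\<nexists>p. prime p \<and> [p = a] (mod n)"
  obtain a' where a': "[a * a' = 1] (mod n)"
    using cong_solve_coprime_nat[OF a] by auto
  have fin: "finite (dchars n)" using finite_dchars[OF n] .
  have "coprime (a * a') n" using a' by (metis cong_imp_coprime cong_sym coprime_1_left)
  then have "dchar0 n a' = 1" by (simp add: dchar0_def)
  obtain C1 where C1: "\<And>x. (\<Sum>k | k \<in> {1..x} \<and> \<not> prime k. mangoldt k / real k) \<le> C1"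
    using mangoldt_over_nonprime_bounded by blast
  obtain C2 where C2: "\<And>x. x > 0 \<Longrightarrow> Re (mangoldt_twisted (dchar0 n) x) \<ge> ln x - C2"
    using mangoldt_twisted_dchar0_lower[OF n] by blast
  define C3 where "C3 = (\<Sum>\<chi>\<in>dchars n - {dchar0 n}. 16 * n / norm (lim (L1_partial \<chi>)))"
  define K where "K = card (dchars n) * C1 + C2 + C3"
  have "ln (real x) \<le> K" if x: "x > 0" for x :: nat
  proof -
    have "(\<Sum>k | k \<in> {1..x} \<and> [k = a] (mod n). mangoldt k / real k) \<le>
        (\<Sum>k | k \<in> {1..x} \<and> \<not> prime k. mangoldt k / real k)"
      using no by (intro sum_mono2) (auto simp: mangoldt_nonneg)
    then have "card (dchars n) * (\<Sum>k | k \<in> {1..x} \<and> [k = a] (mod n). mangoldt k / real k) \<le>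
        card (dchars n) * C1"
      using C1[of x] by (intro mult_left_mono) auto
    moreover have "(\<Sum>\<chi>\<in>dchars n. \<chi> a' * mangoldt_twisted \<chi> x) = mangoldt_twisted (dchar0 n) x +
        (\<Sum>\<chi>\<in>dchars n - {dchar0 n}. \<chi> a' * mangoldt_twisted \<chi> x)"
      using sum.remove[OF fin dchar0_in_dchars, of "\<lambda>\<chi>. \<chi> a' * mangoldt_twisted \<chi> x"]
        \<open>dchar0 n a' = 1\<close> by simp
    moreover have "norm (\<Sum>\<chi>\<in>dchars n - {dchar0 n}. \<chi> a' * mangoldt_twisted \<chi> x) \<le> C3"
      unfolding C3_def
    proof (rule sum_norm_le)
      fix \<chi> assume \<chi>: "\<chi> \<in> dchars n - {dchar0 n}"
      have "norm (\<chi> a') * norm (mangoldt_twisted \<chi> x) \<le> 1 * (16 * n / norm (lim (L1_partial \<chi>)))"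
        using \<chi> n dchars_norm_le mangoldt_twisted_bounded dchars_L1_nonzero
        by (intro mult_mono) auto
      then show "norm (\<chi> a' * mangoldt_twisted \<chi> x) \<le> 16 * n / norm (lim (L1_partial \<chi>))"
        by (simp add: norm_mult)
    qed
    ultimately show ?thesis
      using mangoldt_twisted_sum[OF n a', of x] C2[OF x]
        abs_Re_le_cmod[of "\<Sum>\<chi>\<in>dchars n - {dchar0 n}. \<chi> a' * mangoldt_twisted \<chi> x"]
      unfolding K_def by (simp add: complex_eq_iff)
  qed
  then show False using ex_ln_nat_gt[of K] by (meson not_le)
qed

section \<open>Coverings of the exponents\<close>

definition pow2_hits :: "int \<Rightarrow> nat \<Rightarrow> nat \<Rightarrow> bool" where
  "pow2_hits a k p \<longleftrightarrow> [2 ^ k = a] (mod int p)"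

text \<open>Exponent 0 is left out: for odd \<open>a\<close> the number \<open>a - 1\<close> is
  even, so its common factor with \<open>b\<close> might only be 2.\<close>

definition covering :: "int \<Rightarrow> nat set \<Rightarrow> bool" where
  "covering a P \<longleftrightarrow> (\<forall>k>0. \<exists>p\<in>P. pow2_hits a k p)"

text \<open>Along a progression of difference \<open>D\<close> the period is the order of
  \<open>2 ^ D\<close>, which is smaller than that of 2 if \<open>D\<close> shares a factor with it.
  The case \<open>c = 0\<close>, \<open>D = 1\<close> concerns all exponents.\<close>

lemma pow2_hits_progression:
  assumes p: "coprime p 2" and hits: "pow2_hits a (c + D * s) p" "pow2_hits a (c + D * t) p"
  shows "[s = t] (mod ord p (2 ^ D))"
proof -
  have "[int (2 ^ (c + D * s)) = int (2 ^ (c + D * t))] (mod int p)"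
    using hits unfolding pow2_hits_def by (simp only: of_nat_power of_nat_numeral) (metis cong_sym cong_trans)
  then have "[2 ^ (c + D * s) = 2 ^ (c + D * t :: nat)] (mod p)"
    unfolding cong_int_iff .
  then have "[2 ^ c * (2 ^ D) ^ s = 2 ^ c * (2 ^ D) ^ (t :: nat)] (mod p)"
    by (simp only: power_add power_mult)
  then have "[(2 ^ D) ^ s = (2 ^ D) ^ (t :: nat)] (mod p)"
    using p by (subst (asm) cong_mult_lcancel_nat) (auto simp: coprime_commute)
  moreover have "coprime p (2 ^ D)" using p by simp
  ultimately show ?thesis using order_divides_expdiff by blast
qed

lemma pow2_hits_shift:
  assumes "ord p 2 dvd j" "pow2_hits a (k + j) p"
  shows "pow2_hits a k p"
proof -
  have "[2 ^ j = 1] (mod p)" using assms(1) ord_divides by blast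
  then have "[int (2 ^ j) = int 1] (mod int p)" unfolding cong_int_iff .
  then have "[2 ^ k * 2 ^ j = 2 ^ k * 1] (mod int p)" by (intro cong_scalar_left) simp
  then have "[2 ^ (k + j) = 2 ^ k] (mod int p)" by (simp add: power_add)
  then show ?thesis using assms(2) unfolding pow2_hits_def by (metis cong_sym cong_trans)
qed

text \<open>Count over a common period \<open>M\<close>: in every block of length \<open>h p\<close>
  the prime \<open>p\<close> hits at most one index.\<close>

lemma covering_density:
  assumes P: "finite P" "\<And>p. p \<in> P \<Longrightarrow> coprime p 2"
    and cov: "\<And>t. \<exists>p\<in>P. pow2_hits a (c + D * t) p"
  shows "1 \<le> (\<Sum>p\<in>P. 1 / real (ord p (2 ^ D)))"
proof -
  define h where "h p = ord p (2 ^ D)" for p :: nat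
  define M where "M = (\<Prod>p\<in>P. h p)"
  define A where "A p = {t. t < M \<and> pow2_hits a (c + D * t) p}" for p
  have h: "h p > 0" if "p \<in> P" for p using P(2)[OF that] by (simp add: h_def)
  have M: "M > 0" unfolding M_def using h by (simp add: prod_pos)
  have card: "real (card (A p)) \<le> M / h p" if p: "p \<in> P" for p
  proof -
    have dvd: "h p dvd M" unfolding M_def using P(1) p by (rule dvd_prodI)
    have "inj_on (\<lambda>t. t div h p) (A p)"
    proof (rule inj_onI)
      fix s t assume st: "s \<in> A p" "t \<in> A p" "s div h p = t div h p"
      have "[s = t] (mod h p)"
        unfolding h_def using st pow2_hits_progression[OF P(2)[OF p], of a c D s t] by (simp add: A_def)
      then show "s = t" using st(3) by (metis cong_def div_mult_mod_eq)
    qed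
    moreover have "(\<lambda>t. t div h p) ` A p \<subseteq> {..<M div h p}"
      using dvd h[OF p] by (auto simp: A_def less_mult_imp_div_less)
    ultimately have "card (A p) \<le> M div h p" using card_inj_on_le[of _ "A p" "{..<M div h p}"] by simp
    then show ?thesis using dvd by (metis of_nat_le_iff real_of_nat_div)
  qed
  have "{..<M} = (\<Union>p\<in>P. A p)" using cov by (auto simp: A_def)
  then have "M = card (\<Union>p\<in>P. A p)" by (metis card_lessThan)
  also have "\<dots> \<le> (\<Sum>p\<in>P. card (A p))" by (rule card_UN_le[OF P(1)])
  finally have "real M \<le> real (\<Sum>p\<in>P. card (A p))" by (simp only: of_nat_le_iff)
  also have "\<dots> \<le> (\<Sum>p\<in>P. M / h p)" using card by (simp add: sum_mono)
  also have "\<dots> = M * (\<Sum>p\<in>P. 1 / real (h p))" by (simp add: sum_distrib_left)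
  finally show ?thesis using M by (simp add: h_def)
qed

definition avoids :: "int \<Rightarrow> nat set \<Rightarrow> nat \<Rightarrow> nat \<Rightarrow> bool" where
  "avoids a X c D \<longleftrightarrow> (\<forall>t. \<forall>p\<in>X. \<not> pow2_hits a (c + D * t) p)"

text \<open>A prime \<open>p\<close> of order \<open>2 D\<close> hits at most one of the two halves \<open>c\<close> and \<open>c + D\<close> modulo \<open>2 D\<close> of the progression.\<close>

lemma avoids_insert:
  assumes X: "avoids a X c D" and p: "coprime p 2" "ord p 2 = 2 * D"
  shows "\<exists>c'\<ge>c. avoids a (insert p X) c' (2 * D)"
proof (rule ccontr)
  assume none: "\<not> ?thesis"
  have D: "D > 0" using p by (metis mult_0_right ord_gt_0_iff less_irrefl bot_nat_0.not_eq_extremum)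
  have sub: "\<not> pow2_hits a (c' + 2 * D * t) r" if "r \<in> X" "c' = c \<or> c' = c + D" for c' t r
  proof -
    have "c' + 2 * D * t = c + D * (2 * t) \<or> c' + 2 * D * t = c + D * (2 * t + 1)"
      using that(2) by auto
    then show ?thesis using X that(1) unfolding avoids_def by metis
  qed
  obtain s where s: "pow2_hits a (c + 2 * D * s) p"
    using none sub unfolding avoids_def by (metis insert_iff order_refl)
  obtain t where t: "pow2_hits a (c + D + 2 * D * t) p"
    using none sub unfolding avoids_def by (metis insert_iff le_add1)
  have "[c + 2 * D * s = c + D + 2 * D * t] (mod 2 * D)"
    using pow2_hits_progression[OF p(1), of a 0 1 "c + 2 * D * s" "c + D + 2 * D * t"] s t p(2)
    by simp
  then have "[0 + (c + 2 * D * s) = D + (c + 2 * D * t)] (mod 2 * D)" by (simp add: ac_simps)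
  moreover have "[c + 2 * D * s = c + 2 * D * t] (mod 2 * D)" by (simp add: cong_def)
  ultimately have "[0 = D] (mod 2 * D)"
    by (metis cong_add_lcancel_nat cong_add_rcancel_nat cong_sym cong_trans)
  then show False using D by (simp add: cong_def)
qed

lemma covering_density_avoiding:
  assumes P: "finite P" "\<And>p. p \<in> P \<Longrightarrow> coprime p 2"
    and cov: "covering a P" and av: "avoids a X c D" and c: "c > 0"
  shows "1 \<le> (\<Sum>p\<in>P - X. 1 / real (ord p (2 ^ D)))"
proof (rule covering_density)
  show "\<exists>p\<in>P - X. pow2_hits a (c + D * t) p" for t
    using cov av c unfolding covering_def avoids_def by (meson Diff_iff add_pos_nonneg zero_le)
qed (use P in auto)

text \<open>The exponent of \<open>q\<close> in an lcm is the maximum of its exponents in the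
  members, so one member attains it.\<close>

lemma prime_power_dvd_Lcm:
  fixes q :: nat
  assumes q: "prime q" "e > 0" and S: "finite S" "0 \<notin> S" "q ^ e dvd Lcm S"
  shows "\<exists>s\<in>S. q ^ e dvd s"
  using S
proof (induction S rule: finite_induct)
  case empty
  then show ?case using q by auto
next
  case (insert x S)
  have nz: "x \<noteq> 0" "Lcm S \<noteq> 0" using insert by (auto simp: Lcm_0_iff)
  have "e \<le> multiplicity q (lcm x (Lcm S))"
    using insert.prems nz q by (subst power_dvd_iff_le_multiplicity[symmetric]) (auto simp: lcm_eq_0_iff)
  then have "e \<le> multiplicity q x \<or> e \<le> multiplicity q (Lcm S)"
    using multiplicity_lcm[OF nz, of q] q(1) by (simp add: le_max_iff_disj)
  then have "q ^ e dvd x \<or> q ^ e dvd Lcm S" using multiplicity_dvd' by blast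
  then show ?case using insert by auto
qed

text \<open>If \<open>k\<close> is missed by the primes whose order is not divisible by \<open>q\<^sup>e\<close>, take a common multiple \<open>N\<close> of their
  orders with \<open>q\<^sup>e\<close> not dividing \<open>N\<close>. The \<open>q\<close> exponents \<open>k + t N\<close> with \<open>t < q\<close> must then be hit by \<open>q\<close> distinct
  primes.\<close>

lemma covering_reduce:
  assumes P: "finite P" "\<And>p. p \<in> P \<Longrightarrow> coprime p 2" and cov: "covering a P"
    and q: "prime q" "e > 0" and card: "card {p \<in> P. q ^ e dvd ord p 2} < q"
  shows "covering a {p \<in> P. \<not> q ^ e dvd ord p 2}"
proof (rule ccontr)
  let ?J = "{p \<in> P. q ^ e dvd ord p 2}" and ?K = "{p \<in> P. \<not> q ^ e dvd ord p 2}"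
  assume "\<not> covering a ?K"
  then obtain k where k: "k > 0" "\<And>p. p \<in> ?K \<Longrightarrow> \<not> pow2_hits a k p" unfolding covering_def by blast
  define N where "N = Lcm ((\<lambda>p. ord p 2) ` ?K)"
  have N: "\<not> q ^ e dvd N"
  proof
    assume "q ^ e dvd N"
    then have "\<exists>s\<in>(\<lambda>p. ord p 2) ` ?K. q ^ e dvd s"
      unfolding N_def using P q by (intro prime_power_dvd_Lcm) (auto simp: ord_eq_0)
    then show False by auto
  qed
  have "\<exists>p\<in>?J. pow2_hits a (k + t * N) p" for t
  proof -
    obtain p where p: "p \<in> P" "pow2_hits a (k + t * N) p"
      using cov k(1) unfolding covering_def by (meson add_pos_nonneg zero_le)
    moreover have "p \<notin> ?K"
    proof
      assume "p \<in> ?K"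
      then have "ord p 2 dvd N" unfolding N_def by (intro dvd_Lcm) auto
      then show False using pow2_hits_shift[OF _ p(2)] k(2)[OF \<open>p \<in> ?K\<close>] by simp
    qed
    ultimately show ?thesis by blast
  qed
  then obtain f where f: "\<And>t. f t \<in> ?J" "\<And>t. pow2_hits a (k + t * N) (f t)" by metis
  have le: "s = t" if "s \<le> t" "t < q" "f s = f t" for s t
  proof (rule ccontr)
    assume "s \<noteq> t"
    have "[k + s * N = k + t * N] (mod ord (f s) 2)"
      using pow2_hits_progression[of "f s" a 0 1 "k + s * N" "k + t * N"] f(2)[of s] f(2)[of t]
        f(1)[of s] that(3) P(2)[of "f s"] by simp
    \<comment> \<open>Here \<open>q ^ e\<close> divides the order of \<open>f s\<close>. Since
      \<open>0 < t - s < q\<close>, the factor \<open>t - s\<close> is prime to \<open>q\<close>,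
      and \<open>q ^ e\<close> would have to divide \<open>N\<close>.\<close>
    then have "[s * N = t * N] (mod q ^ e)"
      using f(1)[of s] cong_dvd_modulus_nat cong_add_lcancel_nat by blast
    then have "q ^ e dvd t * N - s * N"
      using mod_eq_dvd_iff_nat[of "s * N" "t * N" "q ^ e"] that(1) by (simp add: cong_def)
    then have "q ^ e dvd (t - s) * N" by (simp add: diff_mult_distrib)
    moreover have "coprime (q ^ e) (t - s)"
      using q that \<open>s \<noteq> t\<close> by (auto intro!: prime_imp_coprime dest: dvd_imp_le)
    ultimately show False using N coprime_dvd_mult_right_iff by blast
  qed
  have "inj_on f {..<q}"
  proof (rule inj_onI)
    fix s t assume "s \<in> {..<q}" "t \<in> {..<q}" "f s = f t"
    then show "s = t" using le[of s t] le[of t s] by (cases "s \<le> t") auto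
  qed
  then have "q \<le> card ?J"
    using card_inj_on_le[of f "{..<q}" ?J] f(1) P(1) by auto
  then show False using card by simp
qed

section \<open>Spaced products, explicit orders and factorizations\<close>

lemma prod_spaced_ge:
  fixes S :: "nat set"
  assumes "finite S" "\<And>s. s \<in> S \<Longrightarrow> c \<le> s \<and> [s = c] (mod m)"
  shows "(\<Prod>i<card S. c + m * i) \<le> \<Prod>S"
  using assms
proof (induction "card S" arbitrary: S)
  case 0
  then show ?case by simp
next
  case (Suc n)
  define M where "M = Max S"
  have ne: "S \<noteq> {}" using Suc.hyps(2) by auto
  have M: "M \<in> S" "\<And>s. s \<in> S \<Longrightarrow> s \<le> M" using Suc.prems(1) ne unfolding M_def by auto
  have cardS: "card (S - {M}) = n" using Suc.hyps(2) M(1) by simp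
  have IH: "(\<Prod>i<n. c + m * i) \<le> \<Prod>(S - {M})"
    using Suc.hyps(1)[of "S - {M}"] cardS Suc.prems by simp
  \<comment> \<open>All \<open>n + 1\<close> elements lie among \<open>c\<close>,
    \<open>c + m\<close>, ..., \<open>M\<close>, so there are at least \<open>n\<close> steps up to
    \<open>M\<close>.\<close>
  have "c + m * n \<le> M"
  proof (cases "m = 0")
    case True
    then show ?thesis using Suc.prems(2)[OF M(1)] by simp
  next
    case False
    have form: "\<exists>j. s = c + m * j" if "s \<in> S" for s
    proof -
      have "c \<le> s" "s mod m = c mod m" using Suc.prems(2)[OF that] by (auto simp: cong_def)
      then have "m dvd s - c" by (metis mod_eq_dvd_iff_nat)
      then show ?thesis using Suc.prems(2)[OF that] by (metis dvd_def le_add_diff_inverse)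
    qed
    obtain j where j: "M = c + m * j" using form[OF M(1)] by blast
    have "S \<subseteq> (\<lambda>i. c + m * i) ` {..j}"
    proof
      fix s assume s: "s \<in> S"
      then obtain i where "s = c + m * i" using form by blast
      moreover have "i \<le> j" using M(2)[OF s] calculation j False by simp
      ultimately show "s \<in> (\<lambda>i. c + m * i) ` {..j}" by blast
    qed
    then have "card S \<le> card {..j}" by (meson surj_card_le finite_atMost)
    then show ?thesis using Suc.hyps(2) j by simp
  qed
  then have "(\<Prod>i<n. c + m * i) * (c + m * n) \<le> \<Prod>(S - {M}) * M"
    using IH by (intro mult_mono) auto
  also have "\<dots> = \<Prod>S" using M(1) Suc.prems(1) by (simp add: prod.remove mult.commute)
  finally show ?case using Suc.hyps(2)[symmetric] by simp
qed

text \<open>Minimality is stated over an explicit list so that the simplifier can evaluate it for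
  numerals.\<close>

lemma ord_eqI:
  assumes "h > 0" "[a ^ h = 1] (mod n)" "list_all (\<lambda>i. a ^ i mod n \<noteq> 1 mod (n::nat)) [1..<h]"
  shows "ord n a = h"
proof -
  have dvd: "ord n a dvd h" using assms(2) ord_divides by blast
  then have "ord n a > 0" "ord n a \<le> h" using assms(1) by (auto simp: dvd_imp_le intro: Nat.gr0I)
  moreover have "\<not> ord n a < h"
  proof
    assume "ord n a < h"
    then have "ord n a \<in> set [1..<h]" using \<open>ord n a > 0\<close> by (simp add: Suc_le_eq)
    then have "\<not> [a ^ ord n a = 1] (mod n)" using assms(3) unfolding list_all_iff cong_def by blast
    then show False using ord by blast
  qed
  ultimately show ?thesis by simp
qed

text \<open>The bases 2, 4, 16 and 256 are \<open>2 ^ D\<close> for the differences \<open>D\<close>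
  = 1, 2, 4, 8 of the progressions.\<close>

lemma ord_3: "ord 3 (2::nat) = 2" "ord 3 (4::nat) = 1"
  by (rule ord_eqI; simp add: cong_def upt_rec)+

lemma ords_1: "ord 5 (2::nat) = 4" "ord 7 (2::nat) = 3" "ord 13 (2::nat) = 12" "ord 17 (2::nat) = 8"
   "ord 241 (2::nat) = 24"
  by (rule ord_eqI; simp add: cong_def upt_rec)+

lemma ords_2: "ord 5 (4::nat) = 2" "ord 7 (4::nat) = 3" "ord 13 (4::nat) = 6" "ord 17 (4::nat) = 4"
   "ord 241 (4::nat) = 12"
  by (rule ord_eqI; simp add: cong_def upt_rec)+

lemma ords_4: "ord 7 (16::nat) = 3" "ord 13 (16::nat) = 3" "ord 17 (16::nat) = 2" "ord 241 (16::nat) = 6"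
  by (rule ord_eqI; simp add: cong_def upt_rec)+

lemma ords_8: "ord 7 (256::nat) = 3" "ord 13 (256::nat) = 3" "ord 241 (256::nat) = 3"
  by (rule ord_eqI; simp add: cong_def upt_rec)+

lemma prod_spaced_ge_initial:
  fixes S :: "nat set"
  assumes "finite S" "\<And>s. s \<in> S \<Longrightarrow> c \<le> s \<and> [s = c] (mod m)" "k \<le> card S" "c > 0"
  shows "(\<Prod>i<k. c + m * i) \<le> \<Prod>S"
proof -
  have "(\<Prod>i<k. c + m * i) dvd (\<Prod>i<card S. c + m * i)"
    using assms(3) by (intro prod_dvd_prod_subset) auto
  then have "(\<Prod>i<k. c + m * i) \<le> (\<Prod>i<card S. c + m * i)"
    using assms(4) by (intro dvd_imp_le prod_pos) auto
  then show ?thesis using prod_spaced_ge[OF assms(1,2)] by (rule order.trans)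
qed

lemma dvd_24_criterion:
  fixes n :: nat
  assumes n: "n > 0" "\<And>q. prime q \<Longrightarrow> q \<ge> 5 \<Longrightarrow> \<not> q dvd n" "\<not> 16 dvd n" "\<not> 9 dvd n"
  shows "n dvd 24"
proof -
  obtain k i where k: "n = 2 ^ i * k" "\<not> 2 dvd k"
    using multiplicity_decompose'[of n 2] n(1) by (metis less_irrefl odd_one)
  obtain m j where m: "k = 3 ^ j * m" "\<not> 3 dvd m"
    using multiplicity_decompose'[of k "3::nat"] k(2) by (metis dvd_0_right nat_dvd_1_iff_1 num.distinct(3) numeral_eq_one_iff)
  have "m = 1"
  proof (rule ccontr)
    assume "m \<noteq> 1"
    then obtain q where q: "prime q" "q dvd m" using prime_factor_nat by blast
    have "q \<noteq> 2" "q \<noteq> 3" using q(2) k(2) m by auto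
    moreover have "q \<noteq> 4" using q(1) by (intro notI) simp
    ultimately have "q \<ge> 5" using prime_ge_2_nat[OF q(1)] by linarith
    then show False using n(2)[OF q(1)] q(2) k(1) m(1) by simp
  qed
  moreover have "i \<le> 3"
    using n(3) le_imp_power_dvd[of 4 i "2::nat"] k(1) by (intro leI notI) (auto intro: dvd_mult2)
  moreover have "j \<le> 1"
    using n(4) le_imp_power_dvd[of 2 j "3::nat"] k(1) m(1) by (intro leI notI) (auto intro: dvd_mult2 dvd_mult)
  ultimately have "m = 1" "2 ^ i * 3 ^ j dvd (2 ^ 3 * 3 ^ 1 :: nat)"
    by (simp_all only:) (intro mult_dvd_mono le_imp_power_dvd; simp)
  then show ?thesis using k(1) m(1) by simp
qed

lemma prime_dvd_pow2_24:
  assumes "prime p" "p dvd (2 ^ 24 - 1 :: nat)"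
  shows "p \<in> {3, 5, 7, 13, 17, 241}"
proof -
  have "(2 ^ 24 - 1 :: nat) = 3 * 3 * 5 * 7 * 13 * 17 * 241" by simp
  then have "p dvd 3 \<or> p dvd 5 \<or> p dvd 7 \<or> p dvd 13 \<or> p dvd 17 \<or> p dvd 241"
    using assms by (simp only: prime_dvd_mult_iff) blast
  moreover have "prime (3::nat)" "prime (5::nat)" "prime (7::nat)" "prime (13::nat)" "prime (17::nat)"
    "prime (241::nat)" by simp_all
  ultimately show ?thesis using assms(1) primes_dvd_imp_eq by blast
qed

lemma prime_dvd_pow2_16:
  assumes "prime p" "p dvd (2 ^ 16 - 1 :: nat)"
  shows "p \<in> {3, 5, 17, 257}"
proof -
  have "(2 ^ 16 - 1 :: nat) = 3 * 5 * 17 * 257" by simp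
  then have "p dvd 3 \<or> p dvd 5 \<or> p dvd 17 \<or> p dvd 257"
    using assms by (simp only: prime_dvd_mult_iff) blast
  moreover have "prime (3::nat)" "prime (5::nat)" "prime (17::nat)" "prime (257::nat)" by simp_all
  ultimately show ?thesis using assms(1) primes_dvd_imp_eq by blast
qed

lemma ord_dvd_imp_dvd_diff:
  assumes "ord p a dvd h" "a > 0"
  shows "p dvd a ^ h - (1::nat)"
proof -
  have "[a ^ h = 1] (mod p)" using assms(1) ord_divides by blast
  moreover have "1 \<le> a ^ h" using assms(2) by simp
  ultimately show ?thesis by (metis cong_def mod_eq_dvd_iff_nat)
qed

text \<open>Transfers divisibility of \<open>ord p 2\<close> by 9 or 16 to the orders of 4 and
  16.\<close>

lemma ord_dvd_mult_ord_power: "ord p a dvd D * ord p (a ^ D :: nat)"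
  using ord[of "a ^ D" p] ord_divides by (metis power_mult)

lemma dvd_pred_spaced:
  assumes "m dvd p - 1" "p > (1::nat)"
  shows "m + 1 \<le> p \<and> [p = m + 1] (mod m)"
proof -
  obtain j where j: "p - 1 = m * j" using assms(1) by blast
  then have "j > 0" using assms(2) by (intro Nat.gr0I) auto
  then have "m + 1 \<le> p" using j assms(2) by (cases j) auto
  moreover have "p = 1 + m * j" using j assms(2) by simp
  then have "[p = m + 1] (mod m)" by (metis cong_def mod_mult_self2 mod_add_self1)
  ultimately show ?thesis by blast
qed

section \<open>Inclusion-minimal coverings\<close>

locale minimal_covering =
  fixes a :: int and P :: "nat set"
  assumes finite_P: "finite P" and prime_P: "\<And>p. p \<in> P \<Longrightarrow> prime p" and odd_P: "\<And>p. p \<in> P \<Longrightarrow> odd p"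
    and covering_P: "covering a P" and minimal_P: "\<And>P'. P' \<subset> P \<Longrightarrow> \<not> covering a P'"
begin

lemma coprime_P: "p \<in> P \<Longrightarrow> coprime p 2"
  using odd_P by simp

lemma ge_3_P: "p \<in> P \<Longrightarrow> p \<ge> 3"
  using prime_ge_2_nat[OF prime_P] odd_P by (metis le_neq_implies_less dvd_refl Suc_leI numeral_3_eq_3 numeral_2_eq_2)

lemma ord_pos: "p \<in> P \<Longrightarrow> ord p (2 ^ D) > 0"
  using coprime_P by simp

lemma dvd_ord_imp_dvd_pred:
  assumes "p \<in> P" "d dvd ord p 2"
  shows "d dvd p - 1"
  using order_divides_totient[OF coprime_P[OF assms(1)]] assms totient_prime[OF prime_P[OF assms(1)]]
  by (metis dvd_trans)

lemma card_high_power: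
  assumes "prime q" "e > 0"
  shows "{p \<in> P. q ^ e dvd ord p 2} = {} \<or> q \<le> card {p \<in> P. q ^ e dvd ord p 2}"
proof (rule ccontr)
  assume neg: "\<not> ?thesis"
  then have "covering a {p \<in> P. \<not> q ^ e dvd ord p 2}"
    by (intro covering_reduce[OF finite_P coprime_P covering_P assms]) auto
  then show False using minimal_P[of "{p \<in> P. \<not> q ^ e dvd ord p 2}"] neg by blast
qed

lemma prod_split: "S \<subseteq> P \<Longrightarrow> \<Prod>S * \<Prod>(P - S) = \<Prod>P"
  using finite_P by (simp add: prod.subset_diff mult.commute)

lemma prod_ge_1: "S \<subseteq> P \<Longrightarrow> 1 \<le> \<Prod>S"
  using ge_3_P by (subst One_nat_def, intro Suc_leI prod_pos) force

lemma prod_subset_le: "S \<subseteq> T \<Longrightarrow> T \<subseteq> P \<Longrightarrow> \<Prod>S \<le> \<Prod>T"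
  using prod_ge_1[of T] finite_P by (intro dvd_imp_le prod_dvd_prod_subset) (auto intro: finite_subset)

text \<open>Both 2 and the odd \<open>d\<close> divide \<open>p - 1\<close>, so the spacing is
  \<open>2 * d\<close> rather than \<open>d\<close>.\<close>

lemma spaced_of_dvd_ord:
  assumes "p \<in> P" "odd d" "d dvd ord p 2"
  shows "2 * d + 1 \<le> p \<and> [p = 2 * d + 1] (mod 2 * d)"
proof (rule dvd_pred_spaced)
  have "2 dvd p - 1" using odd_P[OF assms(1)] by simp
  then show "2 * d dvd p - 1"
    using dvd_ord_imp_dvd_pred[OF assms(1,3)] assms(2) by (intro divides_mult) auto
  show "p > 1" using ge_3_P[OF assms(1)] by simp
qed

lemma density:
  assumes "avoids a X c D" "c > 0"
  shows "1 \<le> (\<Sum>p\<in>P - X. 1 / real (ord p (2 ^ D)))"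
  using covering_density_avoiding[OF finite_P coprime_P covering_P assms] .

text \<open>The primes 3, 5 and 17 have orders 2, 4 and 8, so each of them can be avoided by halving the progression.\<close>

lemma density_1: "1 \<le> (\<Sum>p\<in>P. 1 / real (ord p 2))"
  and density_2: "1 \<le> (\<Sum>p\<in>P - {3}. 1 / real (ord p 4))"
  and density_4: "1 \<le> (\<Sum>p\<in>P - {3, 5}. 1 / real (ord p 16))"
  and density_8: "1 \<le> (\<Sum>p\<in>P - {3, 5, 17}. 1 / real (ord p 256))"
proof -
  \<comment> \<open>Starting at 1 and never moving down keeps all exponents positive, as
    \<open>covering\<close> demands.\<close>
  have 1: "avoids a {} 1 1" by (simp add: avoids_def)
  obtain c2 where c2: "1 \<le> c2" "avoids a {3} c2 2"
    using avoids_insert[OF 1, of 3] ord_3 by auto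
  obtain c4 where c4: "c2 \<le> c4" "avoids a {3, 5} c4 4"
    using avoids_insert[OF c2(2), of 5] ords_1 by (auto simp: insert_commute)
  obtain c8 where c8: "c4 \<le> c8" "avoids a {3, 5, 17} c8 8"
    using avoids_insert[OF c4(2), of 17] ords_1 by (auto simp: insert_commute)
  show "1 \<le> (\<Sum>p\<in>P. 1 / real (ord p 2))" using density[OF 1] by simp
  show "1 \<le> (\<Sum>p\<in>P - {3}. 1 / real (ord p 4))" using density[OF c2(2)] c2(1) by simp
  show "1 \<le> (\<Sum>p\<in>P - {3, 5}. 1 / real (ord p 16))" using density[OF c4(2)] c2(1) c4(1) by simp
  show "1 \<le> (\<Sum>p\<in>P - {3, 5, 17}. 1 / real (ord p 256))" using density[OF c8(2)] c2(1) c4(1) c8(1) by simp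
qed

lemma sum_le_card_mult:
  assumes "S \<subseteq> P" "\<And>p. p \<in> S \<Longrightarrow> h \<le> ord p g" "h > 0"
  shows "(\<Sum>p\<in>S. 1 / real (ord p g)) \<le> card S / h"
proof -
  have "(\<Sum>p\<in>S. 1 / real (ord p g)) \<le> (\<Sum>p\<in>S. 1 / real h)"
  proof (rule sum_mono)
    fix p assume "p \<in> S"
    then have "real h \<le> real (ord p g)" using assms(2) by simp
    then show "1 / real (ord p g) \<le> 1 / real h" using assms(3) by (intro frac_le) auto
  qed
  then show ?thesis by simp
qed

section \<open>Excluding coverings with product below 5592405\<close>

context
  assumes small: "\<Prod>P < 5592405"
begin

lemma prod_small: "S \<subseteq> P \<Longrightarrow> \<Prod>S * \<Prod>(P - S) < 5592405"
  using small prod_split by simp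

text \<open>At least \<open>q\<close> primes have an order divisible by \<open>q\<close>, all 1
  modulo \<open>2 * q\<close>. Five of them already multiply to at least
  \<open>11 * 21 * 31 * 41 * 51\<close>, the value for \<open>q = 5\<close>.\<close>

lemma not_dvd_ord_ge_5:
  assumes p: "p \<in> P" and q: "prime q" "q \<ge> 5"
  shows "\<not> q dvd ord p 2"
proof
  assume dvd: "q dvd ord p 2"
  let ?J = "{p \<in> P. q dvd ord p 2}"
  have "q \<le> card ?J" using card_high_power[OF q(1), of 1] p dvd by auto
  then have card: "5 \<le> card ?J" using q(2) by simp
  have oddq: "odd q" using q prime_odd_nat by simp
  have sp: "2 * q + 1 \<le> s \<and> [s = 2 * q + 1] (mod 2 * q)" if "s \<in> ?J" for s
    using spaced_of_dvd_ord[OF _ oddq] that by blast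
  have "(\<Prod>i<5. (2 * q + 1) + 2 * q * i) \<le> \<Prod>?J"
    by (rule prod_spaced_ge_initial[OF _ sp card]) (use finite_P in simp_all)
  also have "\<dots> < 5592405" using prod_subset_le[of ?J P] small by simp
  finally have "(\<Prod>i<5. (2 * q + 1) + 2 * q * i) < 5592405" .
  moreover have "(\<Prod>i<5::nat. (11::nat) + 10 * i) \<le> (\<Prod>i<5. (2 * q + 1) + 2 * q * i)"
  proof (intro prod_mono conjI)
    fix i :: nat
    have "10 * i \<le> 2 * q * i" using q(2) by (intro mult_right_mono) auto
    then show "11 + 10 * i \<le> (2 * q + 1) + 2 * q * i" using q(2) by linarith
  qed simp
  moreover have "(\<Prod>i<5::nat. (11::nat) + 10 * i) = 14973651"
  proof -
    have "{..<5::nat} = {0, 1, 2, 3, 4}" by auto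
    then show ?thesis by simp
  qed
  ultimately show False by simp
qed

text \<open>If \<open>J\<close> is nonempty it has at least three members, all 1 modulo 18, and the
  other primes \<open>Q\<close> have product at most 144. On the progression avoiding 3 and 5,
  \<open>J\<close> covers at most 4/9 and each prime of \<open>R\<close> at most 1/2, so
  \<open>R\<close> has two members. This exhausts the product bound: \<open>Q\<close> is a pair of
  primes from 7 on and \<open>J\<close> a triple, too little for all exponents.\<close>

lemma not_9_dvd_ord:
  assumes p: "p \<in> P"
  shows "\<not> 9 dvd ord p 2"
proof
  assume dvd: "9 dvd ord p 2"
  define J where "J = {p \<in> P. 9 dvd ord p 2}"
  define Q where "Q = P - J"
  define R where "R = Q - {3, 5}"
  have J: "J \<subseteq> P" "finite J" and Q: "Q \<subseteq> P" "finite Q" "J \<inter> Q = {}" "P = J \<union> Q" and R: "R \<subseteq> P" "finite R"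
    using finite_P unfolding J_def Q_def R_def by auto
  have card3: "3 \<le> card J" using card_high_power[of 3 2] p dvd unfolding J_def by auto
  have sp: "19 \<le> s \<and> [s = 19] (mod 18)" if "s \<in> J" for s
    using spaced_of_dvd_ord[of s 9] that unfolding J_def by simp
  \<comment> \<open>38665 is \<open>19 * 37 * 55\<close>; the factors 73 and 91 follow in
    \<open>J4\<close> and \<open>J5\<close>.\<close>
  have J3: "38665 \<le> \<Prod>J"
    using prod_spaced_ge_initial[OF J(2) sp, of "Suc (Suc (Suc 0))"] card3 by simp
  have J4: "2822545 \<le> \<Prod>J" if "4 \<le> card J"
    using prod_spaced_ge_initial[OF J(2) sp, of "Suc (Suc (Suc (Suc 0)))"] that by simp
  have J5: "256851595 \<le> \<Prod>J" if "5 \<le> card J"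
    using prod_spaced_ge_initial[OF J(2) sp, of "Suc (Suc (Suc (Suc (Suc 0))))"] that by simp
  have JQ: "\<Prod>J * \<Prod>Q < 5592405" using prod_small[OF J(1)] unfolding Q_def .
  have "\<Prod>Q \<ge> 1" using prod_ge_1[OF Q(1)] .
  then have "\<Prod>J \<le> \<Prod>J * \<Prod>Q" by simp
  then have card4: "card J \<le> 4" using J5 JQ by (intro leI notI) linarith
  have "38665 * \<Prod>Q \<le> \<Prod>J * \<Prod>Q" using J3 by (intro mult_right_mono) auto
  then have Qle: "\<Prod>Q \<le> 144" using JQ by linarith
  have ordJ: "9 \<le> ord s 16" if "s \<in> J" for s
  proof -
    have "9 dvd 4 * ord s (2 ^ 4)" using ord_dvd_mult_ord_power[of s 2 4] that dvd_trans unfolding J_def by blast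
    then have "9 dvd 4 * ord s 16" by simp
    moreover have "coprime 9 (4::nat)" by (simp add: coprime_iff_gcd_eq_1 gcd_non_0_nat)
    ultimately have "9 dvd ord s 16" using coprime_dvd_mult_right_iff by blast
    then show ?thesis using ord_pos[of s 4] that unfolding J_def by (intro dvd_imp_le) auto
  qed
  have ordR: "2 \<le> ord s 16" if "s \<in> R" for s
  proof (rule ccontr)
    assume "\<not> 2 \<le> ord s 16"
    moreover have "0 < ord s 16" using ord_pos[of s 4] that R(1) by auto
    ultimately have "ord s 16 = 1" by linarith
    then have "ord s 16 dvd 1" by (simp only: dvd_refl)
    then have "s dvd 3 * 5" using ord_dvd_imp_dvd_diff[of s 16 1] by simp
    then have "s dvd 3 \<or> s dvd 5" using prime_dvd_mult_iff[OF prime_P] that R(1) by blast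
    then have "s = 3 \<or> s = 5" using primes_dvd_imp_eq[of s 3] primes_dvd_imp_eq[of s 5] prime_P that R(1) by auto
    then show False using that unfolding R_def by blast
  qed
  have "3 \<notin> J" "5 \<notin> J" using sp[of 3] sp[of 5] by auto
  then have "P - {3, 5} = J \<union> R" using J(1) unfolding R_def Q_def by auto
  moreover have "J \<inter> R = {}" using Q(3) unfolding R_def by auto
  ultimately have "1 \<le> (\<Sum>p\<in>J. 1 / real (ord p 16)) + (\<Sum>p\<in>R. 1 / real (ord p 16))"
    using density_4 J(2) R(2) by (simp add: sum.union_disjoint)
  also have "\<dots> \<le> card J / real 9 + card R / real 2"
    using J(1) R(1) ordJ ordR by (intro add_mono sum_le_card_mult) auto
  \<comment> \<open>With at most one prime in \<open>R\<close> the total would be at most 4/9 +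
    1/2.\<close>
  finally have R2: "2 \<le> card R" using card4 by (intro leI notI) (simp add: less_2_cases_iff; linarith)
  have spR: "7 \<le> s \<and> [s = 7] (mod 2)" if "s \<in> R" for s
  proof -
    have "odd s" "s \<ge> 3" "s \<noteq> 3" "s \<noteq> 5" using that R(1) odd_P ge_3_P unfolding R_def by auto
    moreover have "s \<noteq> 4" "s \<noteq> 6" using \<open>odd s\<close> by auto
    ultimately show ?thesis by (auto simp: cong_def odd_iff_mod_2_eq_one)
  qed
  have RQ: "R \<subseteq> Q" unfolding R_def by auto
  have R63: "63 \<le> \<Prod>R"
    using prod_spaced_ge_initial[OF R(2) spR, of "Suc (Suc 0)"] R2 by simp
  have "\<not> 3 \<le> card R"
  proof
    assume "3 \<le> card R"
    then have "693 \<le> \<Prod>R" using prod_spaced_ge_initial[OF R(2) spR, of "Suc (Suc (Suc 0))"] by simp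
    then show False using prod_subset_le[OF RQ Q(1)] Qle by simp
  qed
  then have cardR: "card R = 2" using R2 by simp
  have "s \<notin> Q" if "s \<in> {3, 5}" for s
  proof
    assume "s \<in> Q"
    then have "\<Prod>(insert s R) \<le> \<Prod>Q" using prod_subset_le[of "insert s R" Q] RQ Q(1) by auto
    moreover have "s \<notin> R" using that unfolding R_def by auto
    ultimately have "s * \<Prod>R \<le> 144" using Qle R(2) by simp
    moreover have "3 * 63 \<le> s * \<Prod>R" using that R63 by (intro mult_mono) auto
    ultimately show False by simp
  qed
  then have QR: "Q = R" unfolding R_def by auto
  have cardJ: "card J = 3"
  proof (rule ccontr)
    assume "card J \<noteq> 3"
    then have "2822545 * 63 \<le> \<Prod>J * \<Prod>Q" using card3 J4 R63 QR by (intro mult_mono) auto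
    then show False using JQ by linarith
  qed
  obtain x y where xy: "Q = {x, y}" "x \<noteq> y" using cardR QR by (auto simp: card_2_iff)
  have ord3: "3 \<le> ord s 2" and ord4: "s \<noteq> 7 \<Longrightarrow> 4 \<le> ord s 2" if "s \<in> Q" for s
  proof -
    have sP: "s \<in> P" and s7: "7 \<le> s" using that Q(1) spR QR by auto
    have pos: "ord s 2 > 0" using ord_pos[OF sP, of 1] by simp
    have "ord s 2 \<noteq> 1"
      using ord_dvd_imp_dvd_diff[of s 2 1] s7 by auto
    moreover have "ord s 2 \<noteq> 2"
      using ord_dvd_imp_dvd_diff[of s 2 2] dvd_imp_le[of s 3] s7 by auto
    ultimately show "3 \<le> ord s 2" using pos by linarith
    have "s = 7" if "ord s 2 = 3"
    proof -
      have "s dvd 7" using ord_dvd_imp_dvd_diff[of s 2 3] that by simp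
      then show ?thesis using s7 dvd_imp_le[of s 7] by simp
    qed
    then show "4 \<le> ord s 2" if "s \<noteq> 7" using \<open>3 \<le> ord s 2\<close> that by linarith
  qed
  have inv: "1 / real (ord s 2) \<le> 1 / real h" if "h \<le> ord s 2" "h > 0" for s h
    using that by (intro frac_le) auto
  have "(\<Sum>p\<in>Q. 1 / real (ord p 2)) = 1 / real (ord x 2) + 1 / real (ord y 2)" using xy by simp
  \<comment> \<open>Only 7 has order 3, so at most one term reaches 1/3. With 3/9 from
    \<open>J\<close> the total is 11/12.\<close>
  also have "\<dots> \<le> 1 / 3 + 1 / 4"
  proof (cases "x = 7")
    case True
    then have "1 / real (ord x 2) \<le> 1 / real 3" "1 / real (ord y 2) \<le> 1 / real 4"
      using ord3[of x] ord4[of y] xy by (auto intro!: inv simp del: of_nat_numeral)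
    then show ?thesis by simp
  next
    case False
    then have "1 / real (ord x 2) \<le> 1 / real 4" "1 / real (ord y 2) \<le> 1 / real 3"
      using ord4[of x] ord3[of y] xy by (auto intro!: inv simp del: of_nat_numeral)
    then show ?thesis by simp
  qed
  finally have "(\<Sum>p\<in>Q. 1 / real (ord p 2)) \<le> 1 / 3 + 1 / 4" .
  moreover have "(\<Sum>p\<in>J. 1 / real (ord p 2)) \<le> card J / real 9"
    using ord_pos[of _ 1] by (intro sum_le_card_mult J(1)) (auto simp: J_def intro: dvd_imp_le)
  moreover have "1 \<le> (\<Sum>p\<in>J. 1 / real (ord p 2)) + (\<Sum>p\<in>Q. 1 / real (ord p 2))"
    using density_1 unfolding sum.union_disjoint[OF J(2) Q(2,3), symmetric] Q(4)[symmetric] .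
  ultimately show False using cardJ by simp
qed

lemma P_if_not_16_dvd:
  assumes "p \<in> P" "\<not> 16 dvd ord p 2"
  shows "p \<in> {3, 5, 7, 13, 17, 241}"
proof -
  have "ord p 2 dvd 24"
    using assms not_dvd_ord_ge_5 not_9_dvd_ord ord_pos[of p 1] by (intro dvd_24_criterion) auto
  then show ?thesis using ord_dvd_imp_dvd_diff[of p 2 24] prime_P[OF assms(1)] by (intro prime_dvd_pow2_24) auto
qed

text \<open>Densities and product as functions of six membership bits, so that a case split over the
  bits decides the remaining inequalities.\<close>

lemma sum_known_primes:
  assumes "Q \<subseteq> {3, 5, 7, 13, 17, 241 :: nat}"
  shows "(\<Sum>p\<in>Q. 1 / real (ord p 2)) = (if 3 \<in> Q then 1/2 else 0) + (if 5 \<in> Q then 1/4 else 0) +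
      (if 7 \<in> Q then 1/3 else 0) + (if 13 \<in> Q then 1/12 else 0) + (if 17 \<in> Q then 1/8 else 0) +
      (if 241 \<in> Q then 1/24 else 0)"
    and "(\<Sum>p\<in>Q - {3}. 1 / real (ord p 4)) = (if 5 \<in> Q then 1/2 else 0) +
      (if 7 \<in> Q then 1/3 else 0) + (if 13 \<in> Q then 1/6 else 0) + (if 17 \<in> Q then 1/4 else 0) +
      (if 241 \<in> Q then 1/12 else 0)"
    and "(\<Sum>p\<in>Q - {3, 5}. 1 / real (ord p 16)) =
      (if 7 \<in> Q then 1/3 else 0) + (if 13 \<in> Q then 1/3 else 0) + (if 17 \<in> Q then 1/2 else 0) +
      (if 241 \<in> Q then 1/6 else 0)"
    and "(\<Sum>p\<in>Q - {3, 5, 17}. 1 / real (ord p 256)) =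
      (if 7 \<in> Q then 1/3 else 0) + (if 13 \<in> Q then 1/3 else 0) + (if 241 \<in> Q then 1/3 else 0)"
    and "\<Prod>Q = (if 3 \<in> Q then 3 else 1) * (if 5 \<in> Q then 5 else 1) * (if 7 \<in> Q then 7 else 1) *
      (if 13 \<in> Q then 13 else 1) * (if 17 \<in> Q then 17 else 1) * (if 241 \<in> Q then 241 else 1)"
proof -
  have sets: "Q = {p \<in> {3, 5, 7, 13, 17, 241}. p \<in> Q}" "Q - {3} = {p \<in> {5, 7, 13, 17, 241}. p \<in> Q}"
    "Q - {3, 5} = {p \<in> {7, 13, 17, 241}. p \<in> Q}" "Q - {3, 5, 17} = {p \<in> {7, 13, 241}. p \<in> Q}"
    using assms by auto
  have filter: "(\<Sum>p\<in>{p \<in> A. p \<in> Q}. f p) = (\<Sum>p\<in>A. if p \<in> Q then f p else 0)"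
    if "finite A" for A and f :: "nat \<Rightarrow> real"
    using that by (rule sum.inter_filter)
  have "(\<Sum>p\<in>Q. 1 / real (ord p 2)) = (\<Sum>p\<in>{3, 5, 7, 13, 17, 241}. if p \<in> Q then 1 / real (ord p 2) else 0)"
    by (subst sets(1), subst filter) auto
  then show "(\<Sum>p\<in>Q. 1 / real (ord p 2)) = (if 3 \<in> Q then 1/2 else 0) + (if 5 \<in> Q then 1/4 else 0) +
      (if 7 \<in> Q then 1/3 else 0) + (if 13 \<in> Q then 1/12 else 0) + (if 17 \<in> Q then 1/8 else 0) +
      (if 241 \<in> Q then 1/24 else 0)" by (simp add: ord_3 ords_1)
  show "(\<Sum>p\<in>Q - {3}. 1 / real (ord p 4)) = (if 5 \<in> Q then 1/2 else 0) +
      (if 7 \<in> Q then 1/3 else 0) + (if 13 \<in> Q then 1/6 else 0) + (if 17 \<in> Q then 1/4 else 0) +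
      (if 241 \<in> Q then 1/12 else 0)" by (subst sets(2), subst filter) (simp_all add: ords_2)
  show "(\<Sum>p\<in>Q - {3, 5}. 1 / real (ord p 16)) =
      (if 7 \<in> Q then 1/3 else 0) + (if 13 \<in> Q then 1/3 else 0) + (if 17 \<in> Q then 1/2 else 0) +
      (if 241 \<in> Q then 1/6 else 0)" by (subst sets(3), subst filter) (simp_all add: ords_4)
  show "(\<Sum>p\<in>Q - {3, 5, 17}. 1 / real (ord p 256)) =
      (if 7 \<in> Q then 1/3 else 0) + (if 13 \<in> Q then 1/3 else 0) + (if 241 \<in> Q then 1/3 else 0)"
    by (subst sets(4), subst filter) (simp_all add: ords_8)
  have "\<Prod>Q = (\<Prod>p\<in>{3, 5, 7, 13, 17, 241}. if p \<in> Q then p else 1)"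
    by (subst sets(1), subst prod.inter_filter) auto
  then show "\<Prod>Q = (if 3 \<in> Q then 3 else 1) * (if 5 \<in> Q then 5 else 1) * (if 7 \<in> Q then 7 else 1) *
      (if 13 \<in> Q then 13 else 1) * (if 17 \<in> Q then 17 else 1) * (if 241 \<in> Q then 241 else 1)"
    by (simp add: mult.assoc)
qed

text \<open>As for 9, but \<open>J\<close> now has at least two members and all other primes are
  among the six candidates. Two members leave at most 510 for the product of \<open>Q\<close>, three
  leave at most 3.\<close>

lemma not_16_dvd_ord:
  assumes p: "p \<in> P"
  shows "\<not> 16 dvd ord p 2"
proof
  assume dvd: "16 dvd ord p 2"
  define J where "J = {p \<in> P. 16 dvd ord p 2}"
  define Q where "Q = P - J"
  have J: "J \<subseteq> P" "finite J" and Q: "Q \<subseteq> P" "finite Q" "J \<inter> Q = {}" "P = J \<union> Q"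
    using finite_P unfolding J_def Q_def by auto
  have card2: "2 \<le> card J" using card_high_power[of 2 4] p dvd unfolding J_def by auto
  have sp: "97 \<le> s \<and> [s = 97] (mod 16)" if "s \<in> J" for s
  proof -
    have sP: "s \<in> P" and s16: "16 dvd ord s 2" using that unfolding J_def by auto
    obtain j where j: "s - 1 = 16 * j" using dvd_ord_imp_dvd_pred[OF sP s16] by blast
    then have s: "s = 1 + 16 * j" using ge_3_P[OF sP] by simp
    \<comment> \<open>Of the numbers 1 modulo 16 below 97, all but 1 and 17 are composite, and 17
      has order only 8.\<close>
    have "j \<ge> 6"
    proof (rule ccontr)
      assume "\<not> j \<ge> 6"
      then have "j \<in> {0, 1, 2, 3, 4, 5}" by auto
      then have "s \<in> {1, 17, 33, 49, 65, 81}" using s by auto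
      moreover have "s \<noteq> 1" using ge_3_P[OF sP] by auto
      moreover have "s \<noteq> 17" using s16 ords_1(4) by auto
      moreover have "\<not> prime (33::nat)" "\<not> prime (49::nat)" "\<not> prime (65::nat)" "\<not> prime (81::nat)"
        by simp_all
      ultimately show False using prime_P[OF sP] by auto
    qed
    moreover have "[1 + 16 * j = 1 + 16 * 6] (mod 16)" by (simp only: cong_def mod_mult_self2)
    ultimately show ?thesis using s by simp
  qed
  have J2: "10961 \<le> \<Prod>J"
    using prod_spaced_ge_initial[OF J(2) sp, of "Suc (Suc 0)"] card2 by simp
  have J3: "1413969 \<le> \<Prod>J" if "3 \<le> card J"
    using prod_spaced_ge_initial[OF J(2) sp, of "Suc (Suc (Suc 0))"] that by simp
  have J4: "205025505 \<le> \<Prod>J" if "4 \<le> card J"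
    using prod_spaced_ge_initial[OF J(2) sp, of "Suc (Suc (Suc (Suc 0)))"] that by simp
  have JQ: "\<Prod>J * \<Prod>Q < 5592405" using prod_small[OF J(1)] unfolding Q_def .
  have "\<Prod>Q \<ge> 1" using prod_ge_1[OF Q(1)] .
  then have "\<Prod>J \<le> \<Prod>J * \<Prod>Q" by simp
  then have card3: "card J \<le> 3" using J4 JQ by (intro leI notI) linarith
  have "10961 * \<Prod>Q \<le> \<Prod>J * \<Prod>Q" using J2 by (intro mult_right_mono) auto
  then have Q510: "\<Prod>Q \<le> 510" using JQ by linarith
  have Q3: "\<Prod>Q \<le> 3" if "3 \<le> card J"
  proof -
    have "1413969 * \<Prod>Q \<le> \<Prod>J * \<Prod>Q" using J3[OF that] by (intro mult_right_mono) auto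
    then show ?thesis using JQ by linarith
  qed
  have Qsub: "Q \<subseteq> {3, 5, 7, 13, 17, 241}"
    using P_if_not_16_dvd unfolding Q_def J_def by blast
  have split: "(\<Sum>p\<in>P - X. f p) = (\<Sum>p\<in>J. f p) + (\<Sum>p\<in>Q - X. f p)" if "X \<subseteq> {3, 5}" for X and f :: "nat \<Rightarrow> real"
  proof -
    have "s \<notin> X" if "s \<in> J" for s using sp[OF that] \<open>X \<subseteq> {3, 5}\<close> by auto
    then have "P - X = J \<union> (Q - X)" using J(1) unfolding Q_def by auto
    moreover have "J \<inter> (Q - X) = {}" using Q(3) by auto
    ultimately show ?thesis using J(2) Q(2) by (simp add: sum.union_disjoint)
  qed
  have ordJ: "ord s 2 \<ge> 16" "ord s 4 \<ge> 8" "ord s 16 \<ge> 4" "s \<noteq> 257 \<Longrightarrow> ord s 16 \<ge> 8" if "s \<in> J" for s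
  proof -
    have sP: "s \<in> P" and s16: "16 dvd ord s 2" using that unfolding J_def by auto
    have pos: "ord s 2 > 0" "ord s 4 > 0" "ord s 16 > 0"
      using ord_pos[OF sP, of 1] ord_pos[OF sP, of 2] ord_pos[OF sP, of 4] by auto
    show "ord s 2 \<ge> 16" using s16 pos by (intro dvd_imp_le)
    have "2 * 8 dvd 2 * ord s 4" using dvd_trans[OF s16 ord_dvd_mult_ord_power[of s 2 2]] by simp
    then have "8 dvd ord s 4" by presburger
    then show "ord s 4 \<ge> 8" using pos by (intro dvd_imp_le)
    have "4 * 4 dvd 4 * ord s 16" using dvd_trans[OF s16 ord_dvd_mult_ord_power[of s 2 4]] by simp
    then have dvd4: "4 dvd ord s 16" by presburger
    then show ge4: "ord s 16 \<ge> 4" using pos by (intro dvd_imp_le)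
    \<comment> \<open>Order 4 means that \<open>s\<close> divides \<open>2 ^ 16 - 1\<close>, whose
      only prime factor from 97 on is 257.\<close>
    show "ord s 16 \<ge> 8" if "s \<noteq> 257"
    proof (rule ccontr)
      assume "\<not> ord s 16 \<ge> 8"
      then have "ord s 16 = 4" using ge4 dvd4 by presburger
      then have "s dvd 16 ^ 4 - 1" using ord_dvd_imp_dvd_diff[of s 16 4] by simp
      then have "s \<in> {3, 5, 17, 257}" using prime_dvd_pow2_16[OF prime_P[OF sP]] by simp
      then show False using sp[OF \<open>s \<in> J\<close>] that by auto
    qed
  qed
  have d1: "1 \<le> card J / real 16 + (\<Sum>p\<in>Q. 1 / real (ord p 2))"
    using density_1 split[of "{}" "\<lambda>p. 1 / real (ord p 2)"] sum_le_card_mult[OF J(1) ordJ(1)] by simp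
  have d2: "1 \<le> card J / real 8 + (\<Sum>p\<in>Q - {3}. 1 / real (ord p 4))"
    using density_2 split[of "{3}" "\<lambda>p. 1 / real (ord p 4)"] sum_le_card_mult[OF J(1) ordJ(2)] by simp
  have d4: "1 \<le> (\<Sum>p\<in>J. 1 / real (ord p 16)) + (\<Sum>p\<in>Q - {3, 5}. 1 / real (ord p 16))"
    using density_4 split[of "{3, 5}" "\<lambda>p. 1 / real (ord p 16)"] by simp
  show False
  proof (cases "card J = 3")
    case True
    have "\<Prod>Q \<le> 3" using Q3 True by simp
    then have empty: "Q - {3, 5} = {}" 
      using prod_subset_le[of "{s}" Q for s] Q(1) Qsub by force
    \<comment> \<open>Here \<open>J\<close> alone would have to cover the progression that avoids 3
      and 5, with density at most 3/4.\<close>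
    show False using d4 sum_le_card_mult[OF J(1) ordJ(3)] True unfolding empty by simp
  next
    case False
    then have cardJ: "card J = 2" using card2 card3 by simp
    then obtain x y where xy: "J = {x, y}" "x \<noteq> y" by (auto simp: card_2_iff)
    have inv: "1 / real (ord s 16) \<le> 1 / real h" if "h \<le> ord s 16" "h > 0" for s h
      using that by (intro frac_le) auto
    have "(\<Sum>p\<in>J. 1 / real (ord p 16)) = 1 / real (ord x 16) + 1 / real (ord y 16)" using xy by simp
    also have "\<dots> \<le> 1 / 4 + 1 / 8"
    proof (cases "x = 257")
      case True
      then have "1 / real (ord x 16) \<le> 1 / real 4" "1 / real (ord y 16) \<le> 1 / real 8"
        using ordJ(3)[of x] ordJ(4)[of y] xy by (auto intro!: inv simp del: of_nat_numeral)
      then show ?thesis by simp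
    next
      case False
      then have "1 / real (ord x 16) \<le> 1 / real 8" "1 / real (ord y 16) \<le> 1 / real 4"
        using ordJ(4)[of x] ordJ(3)[of y] xy by (auto intro!: inv simp del: of_nat_numeral)
      then show ?thesis by simp
    qed
    finally have d4': "5 / 8 \<le> (\<Sum>p\<in>Q - {3, 5}. 1 / real (ord p 16))" using d4 by simp
    \<comment> \<open>By \<open>d4'\<close> and the bound 510, exactly two of 7, 13, 17 lie in
      \<open>Q\<close> and 241 does not. Then \<open>d2\<close> requires 5, the product leaves only
      5, 7, 13, and these give 2/3 instead of the 7/8 that \<open>d1\<close> demands.\<close>
    show False
      using d1 d2 d4' Q510 cardJ unfolding sum_known_primes[OF Qsub]
      by (simp split: if_splits)
  qed
qed

text \<open>On the last progression 7, 13 and 241 have density 1/3 each, so all three are present.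
  Going back through \<open>density_4\<close>, \<open>density_2\<close> and
  \<open>density_1\<close>, the primes found so far reach only 5/6 each time, which forces 17, then
  5, then 3. The product is then 5592405.\<close>

lemma prod_contradiction: False
proof -
  have Psub: "P \<subseteq> {3, 5, 7, 13, 17, 241}"
    using P_if_not_16_dvd not_16_dvd_ord by blast
  show False
    using small density_1 density_2 density_4 density_8 unfolding sum_known_primes[OF Psub]
    by (simp split: if_splits)
qed

end

lemma prod_ge: "5592405 \<le> \<Prod>P"
  using prod_contradiction by (meson not_le)

end

text \<open>A finite covering contains a minimal one, and dropping primes only lowers the
  product.\<close>

lemma covering_prod_ge:
  assumes P: "finite P" "\<And>p. p \<in> P \<Longrightarrow> prime p" "\<And>p. p \<in> P \<Longrightarrow> odd p" and cov: "covering a P"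
  shows "5592405 \<le> \<Prod>P"
proof -
  let ?A = "{M. M \<subseteq> P \<and> covering a M}"
  have "finite ?A" "?A \<noteq> {}" using P(1) cov by auto
  then obtain M where "M \<in> ?A" and min: "\<forall>M'\<in>?A. M' \<subseteq> M \<longrightarrow> M = M'"
    using finite_has_minimal[of ?A] by blast
  then have M: "M \<subseteq> P" "covering a M" by auto
  interpret minimal_covering a M
  proof unfold_locales
    show "\<not> covering a M'" if "M' \<subset> M" for M' using min M(1) that by auto
  qed (use P M in \<open>auto intro: finite_subset\<close>)
  have "\<Prod>M \<le> \<Prod>P"
    using P M(1) by (intro dvd_imp_le prod_dvd_prod_subset prod_pos) (auto simp: prime_gt_0_nat)
  then show ?thesis using prod_ge by simp
qed

section \<open>From the progression to a covering\<close>

lemma pow2_hits_of_no_prime_shift: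
  fixes a :: int
  assumes b: "b > 0" and odd: "odd a"
    and none: "\<not> (\<exists>n>0. [n = a] (mod b) \<and> (\<exists>(p::int) (k::nat). prime p \<and> n = p + 2 ^ k))"
    and k: "k > 0"
  shows "\<exists>p. prime p \<and> odd p \<and> int p dvd b \<and> pow2_hits a k p"
proof -
  define n where "n = nat b"
  \<comment> \<open>The difference may be negative, so its residue modulo \<open>b\<close>
    represents it in Dirichlet's theorem for naturals.\<close>
  define c where "c = nat ((a - 2 ^ k) mod b)"
  have n: "n > 0" "int n = b" using b by (auto simp: n_def)
  have c: "[int c = a - 2 ^ k] (mod b)" using b by (simp add: c_def cong_def)
  have "\<not> coprime c n"
  proof
    assume "coprime c n"
    then obtain p where p: "prime p" "[p = c] (mod n)" using dirichlet_prime_exists n(1) by blast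
    have "[int p = int c] (mod b)" using p(2) n(2) cong_int_iff by metis
    then have "[int p = a - 2 ^ k] (mod b)" using c cong_trans by blast
    then have "[int p + 2 ^ k = (a - 2 ^ k) + 2 ^ k] (mod b)" by (intro cong_add) auto
    moreover have "int p + 2 ^ k > 0" by (simp add: add_nonneg_pos)
    ultimately show False using none p(1) by (metis diff_add_cancel prime_nat_int_transfer)
  qed
  then have "gcd c n \<noteq> 1" by (metis coprime_iff_gcd_eq_1)
  then obtain p where p: "prime p" "p dvd gcd c n" using prime_factor_nat by blast
  then have p: "prime p" "p dvd c" "p dvd n" by auto
  have pb: "int p dvd b" using p(3) n(2) by (metis of_nat_dvd_iff)
  have "[int c = a - 2 ^ k] (mod int p)" using c pb cong_dvd_modulus by blast
  then have "int p dvd a - 2 ^ k" using p(2) by (metis cong_dvd_iff of_nat_dvd_iff)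
  then have "[2 ^ k = a] (mod int p)" by (metis cong_iff_dvd_diff cong_sym)
  moreover have "odd p"
  proof
    assume "even p"
    then have "even (a - 2 ^ k)" using \<open>int p dvd a - 2 ^ k\<close> by (meson dvd_trans even_of_nat_iff)
    then show False using odd k by simp
  qed
  ultimately show ?thesis using p(1) pb unfolding pow2_hits_def by blast
qed

lemma prod_primes_dvd:
  fixes n :: nat
  assumes "finite S" "\<And>p. p \<in> S \<Longrightarrow> prime p \<and> p dvd n"
  shows "\<Prod>S dvd n"
  using assms
proof (induction S rule: finite_induct)
  case (insert p S)
  have "coprime p q" if "q \<in> S" for q
    using insert that by (metis insertI1 insertI2 primes_coprime)
  then have "coprime p (\<Prod>S)" by (intro prod_coprime_right)
  then show ?case using insert by (simp add: divides_mult)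
qed simp

theorem theorem1p2:
  fixes a b :: int
  assumes "b > 0"
    and "\<forall>n>0. [n = a] (mod b) \<longrightarrow> odd n"
    and "\<not> (\<exists>n>0. [n = a] (mod b) \<and> (\<exists>(p::int) (k::nat). prime p \<and> n = p + 2 ^ k))"
  shows "b \<ge> 11184810"
proof -
  \<comment> \<open>A multiple of \<open>b\<close> larger than the absolute value of
    \<open>a\<close>, so that \<open>n\<close> and \<open>n + b\<close> are positive members of the
    progression. Both being odd makes \<open>b\<close> even.\<close>
  define m where "m = b * (\<bar>a\<bar> + 1)"
  define n where "n = a + m"
  have "1 * (\<bar>a\<bar> + 1) \<le> m" unfolding m_def using assms(1) by (intro mult_right_mono) auto
  then have "\<bar>a\<bar> + 1 \<le> m" by simp
  then have "n > 0" unfolding n_def by (simp add: abs_if split: if_splits)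
  moreover have "[n = a] (mod b)" "[n + b = a] (mod b)" by (simp_all add: n_def m_def cong_def)
  ultimately have n: "odd n" "odd (n + b)"
    using assms(1) assms(2)[rule_format, of n] assms(2)[rule_format, of "n + b"] by auto
  then have "even b" by simp
  then have "odd a" using n(1) unfolding n_def m_def by simp
  define P where "P = {p. prime p \<and> odd p \<and> int p dvd b}"
  have "P \<subseteq> {..nat b}" using assms(1) by (auto simp: P_def dest!: zdvd_imp_le)
  then have fin: "finite P" using finite_subset by blast
  have "covering a P"
    using pow2_hits_of_no_prime_shift[OF assms(1) \<open>odd a\<close> assms(3)] unfolding covering_def P_def by blast
  then have "5592405 \<le> \<Prod>P" using fin by (intro covering_prod_ge) (auto simp: P_def)
  \<comment> \<open>The prime 2 takes no part in the covering but divides \<open>b\<close>, which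
    doubles the bound.\<close>
  moreover have "\<Prod>(insert 2 P) dvd nat b"
  proof (rule prod_primes_dvd)
    fix p assume "p \<in> insert 2 P"
    then have "prime p" "int p dvd b" using \<open>even b\<close> by (auto simp: P_def)
    moreover have "b = int (nat b)" using assms(1) by simp
    ultimately show "prime p \<and> p dvd nat b" by (metis int_dvd_int_iff)
  qed (use fin in simp)
  moreover have "\<Prod>(insert 2 P) = 2 * \<Prod>P" using fin by (simp add: P_def)
  ultimately have "2 * 5592405 \<le> nat b" using assms(1) dvd_imp_le[of "2 * \<Prod>P" "nat b"] by simp
  then show ?thesis by simp
qed

end
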